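(* Let $T>0$, $\xi\in\mathbb{R}^d$, $\tfrac13<\alpha\le\tfrac12$, and let $\mathbf{X}=(X,\mathbb{X})$ be a weak geometric $\alpha$-Hölder rough path over $\mathbb{R}^\ell$ on $[0,T]$. Let $\gamma\in[0,1]$ with $\alpha(2+\gamma)>1$ and let $G\in C_b^{1,\gamma}$. Let $F$ be a set-valued map defined on a closed subset $\Omega$ of $\mathbb{R}\times\mathbb{R}^d$, where it is lower semicontinuous, with values in the set $\mathcal{K}(\mathbb{R}^d)$ of nonempty compact subsets of $\mathbb{R}^d$. Assume there is a positive constant $L$ such that $[0,T]\times B(\xi,LT^\alpha)\subset\Omega$ and $$\|F(t,a)\|\le L\qquad\text{for all }(t,a)\in[0,T]\times B(\xi,LT^\alpha).$$ Then there exist a time horizon $T^*\in(0,T)$ and a solution $z$, started at $\xi$ and defined on the time interval $[0,T^*]$, to the rough differential inclusion $$dz_t\in F(t,z_t)\,dt+G(z_t)\,d\mathbf{X}_t .$$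
   Context: $B(a,R)$ is the closed ball of center $a$ and radius $R$; $\|F(t,a)\|\le L$ means $|w|\le L$ for all $w\in F(t,a)$. For a path $y$, write $y_{st}=y_t-y_s$. Function spaces: for an integer $k\ge1$ and $\gamma\in[0,1]$, $C_b^{k,\gamma}$ is the space of bounded maps $G:\mathbb{R}^d\to L(\mathbb{R}^\ell,\mathbb{R}^d)$ that are $k$ times differentiable with bounded derivatives and have a $\gamma$-Hölder $k$-th derivative. Semicontinuity: $F$ is lower semicontinuous on $\Omega$ if for any $(s,w)\in\Omega$, any $w'\in F(s,w)$ and any neighbourhood $V(w')$ of $w'$, there is a neighbourhood $U(s,w)$ of $(s,w)$ in $\Omega$ such that $F(t,a)\cap V(w')\ne\emptyset$ for all $(t,a)\in U(s,w)$. Rough paths: an $\alpha$-Hölder rough path over $\mathbb{R}^\ell$ on $[0,T]$ is a pair $\mathbf{X}=(X,\mathbb{X})$ with $X:[0,T]\to\mathbb{R}^\ell$ $\alpha$-Hölder, $\mathbb{X}:[0,T]^2\to\mathbb{R}^\ell\otimes\mathbb{R}^\ell$ with $\sup_{s\ne t}|\mathbb{X}_{st}|/|t-s|^{2\alpha}<\infty$, and $\mathbb{X}_{rt}-\mathbb{X}_{rs}-\mathbb{X}_{st}=X_{rs}\otimes X_{st}$ for $0\le r\le s\le t\le T$. It is weak geometric if the symmetric part of $\mathbb{X}_{st}$ equals $\frac12X_{st}\otimes X_{st}$ for all $s\le t$. Controlled paths: for $\theta>\alpha$, an $\alpha$-Hölder path $z:[0,S]\to\mathbb{R}^d$ is controlled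 by $X$ with remainder of order $\theta$ if there are $z'\in C^{\theta-\alpha}([0,S],L(\mathbb{R}^\ell,\mathbb{R}^d))$ and $R:[0,S]^2\to\mathbb{R}^d$ with $\sup_{s\ne t}|R_{st}|/|t-s|^\theta<\infty$ and $z_{st}=z'_sX_{st}+R_{st}$; one then calls $(z,z')$ a path controlled by $X$. The same definition is used with $\mathbb{R}^d$ replaced by another finite-dimensional space. Rough integral: if $(z,z')$ is controlled by $X$ with remainder of order $\theta$, $\alpha+\theta>1$, then $(G(z),DG(z)z')$ is a controlled path, and $\int_0^tG(z_s)\,d\mathbf{X}_s$ is the limit, as the mesh of the partition $\{s_i\}$ of $[0,t]$ tends to $0$, of $\sum_i\big(G(z_{s_i})X_{s_is_{i+1}}+(DG(z_{s_i})z'_{s_i})\mathbb{X}_{s_is_{i+1}}\big)$, where $(DG(z)z')(a\otimes b):=(DG(z)[z'a])\,b$. Solution: an $\mathbb{R}^d$-valued path $z$ started from $\xi$ is a solution to $dz_t\in F(t,z_t)dt+G(z_t)d\mathbf{X}_t$ on $[0,T^*]$ if $z$ is part of a path $(z,z')$ controlled by $X$ (with remainder of some order $\theta>\alpha$ with $\alpha+\theta>1$, so that the rough integral below makes sense), and there is an absolutely continuous path $x:[0,T^*]\to\mathbb{R}^d$ starting from $0$ with $\dot x_t\in F(t,z_t)$ for Lebesgue almost every $t\in[0,T^*]$ and $$z_t=\xi+x_t+\int_0^tG(z_s)\,d\mathbf{X}_s\qquad\text{for all }t\in[0,T^*].$$ *)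

theory Defs
  imports "HOL-Analysis.Analysis"
begin

section \<open>Hoelder estimates\<close>

definition holder_on :: "real \<Rightarrow> 'a::metric_space set \<Rightarrow> ('a \<Rightarrow> 'b::real_normed_vector) \<Rightarrow> bool" where
  "holder_on \<beta> A f \<longleftrightarrow> (\<exists>C. \<forall>s\<in>A. \<forall>t\<in>A. norm (f t - f s) \<le> C * dist t s powr \<beta>)"

definition two_param_order_on :: "real \<Rightarrow> real set \<Rightarrow> (real \<Rightarrow> real \<Rightarrow> 'b::real_normed_vector) \<Rightarrow> bool" where
  "two_param_order_on \<beta> A R \<longleftrightarrow>
     (\<exists>C. \<forall>s\<in>A. \<forall>t\<in>A. s \<noteq> t \<longrightarrow> norm (R s t) / \<bar>t - s\<bar> powr \<beta> \<le> C)"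


section \<open>The space $C_b^{1,\gamma}$\<close>

definition deriv_blinfun ::
  "('a::real_normed_vector \<Rightarrow> 'b::real_normed_vector) \<Rightarrow> 'a \<Rightarrow> ('a \<Rightarrow>\<^sub>L 'b)" where
  "deriv_blinfun G x = Blinfun (frechet_derivative G (at x))"

definition C_b_1 :: "real \<Rightarrow> ('a::real_normed_vector \<Rightarrow> 'b::real_normed_vector) \<Rightarrow> bool" where
  "C_b_1 \<gamma> G \<longleftrightarrow>
     bounded (range G) \<and>
     (\<forall>x. G differentiable (at x)) \<and>
     bounded (range (deriv_blinfun G)) \<and>
     holder_on \<gamma> UNIV (deriv_blinfun G)"


section \<open>Rough paths\<close>

text \<open>The tensor product of \<open>real^'l\<close> with itself is realised as \<open>real^'l^'l\<close>.\<close>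

definition outer :: "real^'l \<Rightarrow> real^'l \<Rightarrow> real^'l^'l" where
  "outer a b = (\<chi> i j. a $ i * b $ j)"

text \<open>In a two-parameter map the arguments are in the order of the subscripts: \<open>XX s t\<close>.\<close>

definition rough_path ::
  "real \<Rightarrow> real \<Rightarrow> (real \<Rightarrow> real^'l) \<Rightarrow> (real \<Rightarrow> real \<Rightarrow> real^'l^'l) \<Rightarrow> bool" where
  "rough_path \<alpha> T X XX \<longleftrightarrow>
     holder_on \<alpha> {0..T} X \<and>
     two_param_order_on (2 * \<alpha>) {0..T} XX \<and>
     (\<forall>r s t. 0 \<le> r \<and> r \<le> s \<and> s \<le> t \<and> t \<le> T \<longrightarrow>
        XX r t - XX r s - XX s t = outer (X s - X r) (X t - X s))"

definition weak_geometric_rough_path ::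
  "real \<Rightarrow> real \<Rightarrow> (real \<Rightarrow> real^'l) \<Rightarrow> (real \<Rightarrow> real \<Rightarrow> real^'l^'l) \<Rightarrow> bool" where
  "weak_geometric_rough_path \<alpha> T X XX \<longleftrightarrow>
     rough_path \<alpha> T X XX \<and>
     (\<forall>s t. 0 \<le> s \<and> s \<le> t \<and> t \<le> T \<longrightarrow>
        (1/2) *\<^sub>R (XX s t + transpose (XX s t)) = (1/2) *\<^sub>R outer (X t - X s) (X t - X s))"


section \<open>Controlled paths and rough integration\<close>

definition controlled_path ::
  "real \<Rightarrow> real \<Rightarrow> real \<Rightarrow> (real \<Rightarrow> 'a::real_normed_vector) \<Rightarrow>
   (real \<Rightarrow> 'b::real_normed_vector) \<Rightarrow> (real \<Rightarrow> ('a \<Rightarrow>\<^sub>L 'b)) \<Rightarrow> bool" where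
  "controlled_path \<alpha> \<theta> S X z z' \<longleftrightarrow>
     \<alpha> < \<theta> \<and> holder_on \<alpha> {0..S} z \<and> holder_on (\<theta> - \<alpha>) {0..S} z' \<and>
     (\<exists>R. two_param_order_on \<theta> {0..S} R \<and>
          (\<forall>s\<in>{0..S}. \<forall>t\<in>{0..S}. z t - z s = z' s (X t - X s) + R s t))"

text \<open>The linear extension to all tensors of the map sending \<open>outer a b\<close> to \<open>A a b\<close>.\<close>

definition tensor_apply ::
  "((real^'l) \<Rightarrow>\<^sub>L ((real^'l) \<Rightarrow>\<^sub>L 'b::real_normed_vector)) \<Rightarrow> real^'l^'l \<Rightarrow> 'b" where
  "tensor_apply A M =
     (\<Sum>i\<in>UNIV. \<Sum>j\<in>UNIV. (M $ i $ j) *\<^sub>R blinfun_apply (A (axis i 1)) (axis j 1))"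

lemma tensor_apply_outer: "tensor_apply A (outer a b) = blinfun_apply (blinfun_apply A a) b"
proof -
  have a: "a = (\<Sum>i\<in>UNIV. a $ i *\<^sub>R axis i 1)" and b: "b = (\<Sum>j\<in>UNIV. b $ j *\<^sub>R axis j 1)"
    by (simp_all add: vec_eq_iff axis_def if_distrib cong: if_cong)
  have "blinfun_apply (blinfun_apply A a) b =
      (\<Sum>j\<in>UNIV. \<Sum>i\<in>UNIV. (a $ i * b $ j) *\<^sub>R blinfun_apply (A (axis i 1)) (axis j 1))"
    by (subst a, subst b)
      (simp add: blinfun.sum_left blinfun.sum_right blinfun.scaleR_left blinfun.scaleR_right
        scaleR_sum_right mult.commute)
  also have "\<dots> = tensor_apply A (outer a b)"
    unfolding tensor_apply_def outer_def by (subst sum.swap) simp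
  finally show ?thesis by simp
qed

text \<open>Partitions of \<open>[a, b]\<close> are given by \<open>a = p 0 < \<dots> < p n = b\<close>; for \<open>a = b\<close> only \<open>n = 0\<close>
  is possible and the integral is \<open>0\<close>.\<close>

definition has_rough_integral ::
  "(real \<Rightarrow> real^'l) \<Rightarrow> (real \<Rightarrow> real \<Rightarrow> real^'l^'l) \<Rightarrow>
   (real \<Rightarrow> ((real^'l) \<Rightarrow>\<^sub>L 'b::real_normed_vector)) \<Rightarrow>
   (real \<Rightarrow> ((real^'l) \<Rightarrow>\<^sub>L ((real^'l) \<Rightarrow>\<^sub>L 'b))) \<Rightarrow> real \<Rightarrow> real \<Rightarrow> 'b \<Rightarrow> bool" where
  "has_rough_integral X XX y y' a b I \<longleftrightarrow>
     (\<forall>\<epsilon>>0. \<exists>\<delta>>0. \<forall>(n::nat) p.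
        p 0 = a \<and> p n = b \<and> (\<forall>i<n. p i < p (Suc i) \<and> p (Suc i) - p i < \<delta>) \<longrightarrow>
        norm ((\<Sum>i<n. blinfun_apply (y (p i)) (X (p (Suc i)) - X (p i)) +
                       tensor_apply (y' (p i)) (XX (p i) (p (Suc i)))) - I) < \<epsilon>)"


section \<open>Set-valued maps and rough differential inclusions\<close>

definition lower_semicontinuous_on ::
  "'a::topological_space set \<Rightarrow> ('a \<Rightarrow> 'b::topological_space set) \<Rightarrow> bool" where
  "lower_semicontinuous_on \<Omega> F \<longleftrightarrow>
     (\<forall>p\<in>\<Omega>. \<forall>w\<in>F p. \<forall>V. open V \<and> w \<in> V \<longrightarrow>
        (\<exists>U. openin (top_of_set \<Omega>) U \<and> p \<in> U \<and> (\<forall>q\<in>U. F q \<inter> V \<noteq> {})))"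

definition abs_continuous_on :: "real set \<Rightarrow> (real \<Rightarrow> 'b::real_normed_vector) \<Rightarrow> bool" where
  "abs_continuous_on A x \<longleftrightarrow>
     (\<forall>\<epsilon>>0. \<exists>\<delta>>0. \<forall>(n::nat) a b.
        (\<forall>i<n. a i \<le> b i \<and> {a i..b i} \<subseteq> A) \<and>
        disjoint_family_on (\<lambda>i. {a i<..<b i}) {..<n} \<and>
        (\<Sum>i<n. b i - a i) < \<delta> \<longrightarrow>
        (\<Sum>i<n. norm (x (b i) - x (a i))) < \<epsilon>)"

text \<open>The values of \<open>F\<close> are meaningful on \<open>\<Omega>\<close> only, so the graph of a solution has to stay
  in \<open>\<Omega>\<close>; this is implicit in writing \<open>F (t, z t)\<close>.\<close>

definition rdi_solution ::
  "real \<Rightarrow> (real \<Rightarrow> real^'l) \<Rightarrow> (real \<Rightarrow> real \<Rightarrow> real^'l^'l) \<Rightarrow>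
   (real \<times> (real^'d)) set \<Rightarrow> (real \<times> (real^'d) \<Rightarrow> (real^'d) set) \<Rightarrow>
   (real^'d \<Rightarrow> ((real^'l) \<Rightarrow>\<^sub>L (real^'d))) \<Rightarrow> real^'d \<Rightarrow> real \<Rightarrow> (real \<Rightarrow> real^'d) \<Rightarrow> bool" where
  "rdi_solution \<alpha> X XX \<Omega> F G \<xi> S z \<longleftrightarrow>
     (\<exists>\<theta> z' x.
        \<alpha> + \<theta> > 1 \<and> controlled_path \<alpha> \<theta> S X z z' \<and>
        (\<forall>t\<in>{0..S}. (t, z t) \<in> \<Omega>) \<and>
        abs_continuous_on {0..S} x \<and> x 0 = 0 \<and>
        (AE t in lebesgue_on {0..S}.
           \<exists>v\<in>F (t, z t). (x has_vector_derivative v) (at t within {0..S})) \<and>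
        (\<forall>t\<in>{0..S}.
           has_rough_integral X XX (\<lambda>s. G (z s)) (\<lambda>s. deriv_blinfun G (z s) o\<^sub>L z' s) 0 t
             (z t - \<xi> - x t)))"

end

theory Submission
  imports Defs "HOL-Complex_Analysis.Great_Picard"
begin

text \<open>Let \<open>Z\<close> be an equicontinuous class of paths. By successive refinement one builds a selection
  \<open>u z t \<in> F (t, z t)\<close>, defined for all \<open>z \<in> Z\<close>, which is non-anticipative and which, for each \<open>z\<close>
  and all but countably many \<open>t\<close>, is continuous in \<open>t\<close> and sequentially continuous in the path.
  Feedback in the current value \<open>z t\<close> alone would not do, since a rough path may cross a switching
  surface at too many times; instead the switching is decided by the value of the path at an earlier
  grid time and by the time elapsed since then.

  An Euler scheme with the drift \<open>u\<close>, evaluated along the path stopped at the last grid point, obeys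
  Davie's estimate: with \<open>\<eta> = \<alpha> (2 + \<gamma>) > 1\<close>, the local error of the second order rough expansion
  over \<open>[s, t]\<close> is at most \<open>K (t - s) powr \<eta>\<close>, uniformly in the mesh, if the horizon is short. Hence
  the approximations are uniformly Hoelder; along a subsequence they converge uniformly to some
  \<open>z\<close>, and their drifts converge to \<open>u z\<close> almost everywhere by the stability of the
  selection. The error estimate passes to the limit and makes the compensated Riemann sums converge.\<close>


section \<open>Path-dependent selections\<close>

text \<open>The values of \<open>F\<close> need not be convex. Weak limits of drifts would only
  yield a velocity in the closed convex hull of \<open>F (t, z t)\<close>, and a selection
  continuous in the state may fail to exist. So the drifts must converge almost everywhere, along a
  limit path that is not known in advance: stability is therefore proved for every path of the
  class, with an exceptional set depending on the path. It comes from a threshold that rises with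
  time. Within a grid cell the distances compared with it take finitely many values, fixed by the
  path at the grid time and by the finitely many values of the coarser selection, and a strictly
  increasing level meets each of them only once.

  The order of the constants avoids a circle. The Hoelder constant \<open>3 * incr_const L\<close>
  of the class does not involve the error constant \<open>K\<close>, because on a short horizon the
  local error is at most \<open>(t - s) powr \<alpha>\<close>. Hence the class, and the selection on
  it, are available before any approximate path is built, and the Euler paths are found to lie in
  the class afterwards.\<close>

lemma eventually_less_iff_of_tendsto:
  fixes a b :: "'a \<Rightarrow> real"
  assumes "(a \<longlongrightarrow> a0) Fl" "(b \<longlongrightarrow> b0) Fl" "a0 \<noteq> b0"
  shows "\<forall>\<^sub>F x in Fl. a x < b x \<longleftrightarrow> a0 < b0"
proof (cases "a0 < b0")
  case True
  have "((\<lambda>x. b x - a x) \<longlongrightarrow> b0 - a0) Fl" by (intro tendsto_diff assms)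
  then have "\<forall>\<^sub>F x in Fl. b x - a x > 0" using True by (intro order_tendstoD(1)) auto
  then show ?thesis using True by (auto elim: eventually_mono)
next
  case False
  have "((\<lambda>x. b x - a x) \<longlongrightarrow> b0 - a0) Fl" by (intro tendsto_diff assms)
  then have "\<forall>\<^sub>F x in Fl. b x - a x < 0" using False assms(3) by (intro order_tendstoD(2)) auto
  then show ?thesis using False by (auto elim!: eventually_mono)
qed

lemma eventually_floor_eq:
  fixes x :: real
  assumes "(f \<longlongrightarrow> x) Fl" "x \<notin> \<int>"
  shows "\<forall>\<^sub>F s in Fl. \<lfloor>f s\<rfloor> = \<lfloor>x\<rfloor>"
proof -
  have "real_of_int \<lfloor>x\<rfloor> < x"
    using assms(2) by (metis Ints_of_int floor_correct order_le_less)
  then have "\<forall>\<^sub>F s in Fl. real_of_int \<lfloor>x\<rfloor> < f s" by (rule order_tendstoD[OF assms(1)])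
  moreover have "\<forall>\<^sub>F s in Fl. f s < real_of_int \<lfloor>x\<rfloor> + 1" by (rule order_tendstoD[OF assms(1)]) simp
  ultimately show ?thesis by eventually_elim (simp add: floor_eq_iff)
qed

lemma floor_grid:
  fixes t h :: real
  assumes "h > 0" "t \<ge> 0"
  shows "0 \<le> real_of_int \<lfloor>t / h\<rfloor> * h" "real_of_int \<lfloor>t / h\<rfloor> * h \<le> t" "t - real_of_int \<lfloor>t / h\<rfloor> * h < h"
proof -
  show "0 \<le> real_of_int \<lfloor>t / h\<rfloor> * h" using assms by simp
  have "real_of_int \<lfloor>t / h\<rfloor> \<le> t / h" by simp
  then have "real_of_int \<lfloor>t / h\<rfloor> * h \<le> t / h * h" using assms by (intro mult_right_mono) auto
  then show "real_of_int \<lfloor>t / h\<rfloor> * h \<le> t" using assms by simp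
  have "t / h < real_of_int \<lfloor>t / h\<rfloor> + 1" by linarith
  then have "t / h * h < (real_of_int \<lfloor>t / h\<rfloor> + 1) * h" using assms by (intro mult_strict_right_mono) auto
  then show "t - real_of_int \<lfloor>t / h\<rfloor> * h < h" using assms by (simp add: algebra_simps)
qed

definition converges_before :: "(nat \<Rightarrow> real \<Rightarrow> 'a::topological_space) \<Rightarrow> (real \<Rightarrow> 'a) \<Rightarrow> real \<Rightarrow> bool" where
  "converges_before zs z t \<longleftrightarrow> (\<forall>s\<in>{0..t}. (\<lambda>m. zs m s) \<longlonglongrightarrow> z s)"

text \<open>Demanding convergence on \<open>[0, t]\<close> only is how the selection is kept from looking into the
  future: the value at time \<open>t\<close> may only depend on the path up to time \<open>t\<close>.\<close>

definition locally_constant_at ::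
  "(real \<Rightarrow> 'a::topological_space) set \<Rightarrow> real \<Rightarrow> ((real \<Rightarrow> 'a) \<Rightarrow> real \<Rightarrow> 'b) \<Rightarrow> (real \<Rightarrow> 'a) \<Rightarrow> real \<Rightarrow> bool" where
  "locally_constant_at Z S u z t \<longleftrightarrow>
     (\<forall>\<^sub>F s in at t within {0..S}. u z s = u z t) \<and>
     (\<forall>zs. range zs \<subseteq> Z \<longrightarrow> converges_before zs z t \<longrightarrow> (\<forall>\<^sub>F m in sequentially. u (zs m) t = u z t))"

text \<open>The three clauses are what a further refinement consumes. The finite range makes the
  closure of the graph compact and leaves finitely many distances to compare. The margin \<delta>,
  uniform in path and time, carries the \<epsilon>-closeness over to limit points of the graph. The
  finite exceptional sets become countable after infinitely many refinements.\<close>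

definition approx_selection ::
  "(real \<times> 'a::metric_space) set \<Rightarrow> (real \<times> 'a \<Rightarrow> 'b::metric_space set) \<Rightarrow> (real \<Rightarrow> 'a) set \<Rightarrow> real \<Rightarrow>
   real \<Rightarrow> ((real \<Rightarrow> 'a) \<Rightarrow> real \<Rightarrow> 'b) \<Rightarrow> bool" where
  "approx_selection K F Z S \<epsilon> u \<longleftrightarrow>
     (\<exists>W. finite W \<and> (\<forall>z\<in>Z. \<forall>t\<in>{0..S}. u z t \<in> W)) \<and>
     (\<exists>\<delta>>0. \<forall>z\<in>Z. \<forall>t\<in>{0..S}. \<forall>q\<in>K. dist q (t, z t) < \<delta> \<longrightarrow> F q \<inter> ball (u z t) \<epsilon> \<noteq> {}) \<and>
     (\<forall>z\<in>Z. \<exists>N. finite N \<and> (\<forall>t\<in>{0..S} - N. locally_constant_at Z S u z t))"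

lemma approx_selection_range:
  assumes "approx_selection K F Z S \<epsilon> u"
  obtains W where "finite W" "\<And>z t. z \<in> Z \<Longrightarrow> t \<in> {0..S} \<Longrightarrow> u z t \<in> W"
  using assms[unfolded approx_selection_def, THEN conjunct1] that by blast

lemma approx_selection_margin:
  assumes "approx_selection K F Z S \<epsilon> u"
  obtains \<delta> where "\<delta> > 0"
    "\<And>z t q. z \<in> Z \<Longrightarrow> t \<in> {0..S} \<Longrightarrow> q \<in> K \<Longrightarrow> dist q (t, z t) < \<delta> \<Longrightarrow> F q \<inter> ball (u z t) \<epsilon> \<noteq> {}"
proof -
  obtain \<delta> where d: "\<delta> > 0"
    "\<forall>z\<in>Z. \<forall>t\<in>{0..S}. \<forall>q\<in>K. dist q (t, z t) < \<delta> \<longrightarrow> F q \<inter> ball (u z t) \<epsilon> \<noteq> {}"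
    using assms[unfolded approx_selection_def, THEN conjunct2, THEN conjunct1] by (elim exE conjE)
  show thesis by (rule that[OF d(1)]) (use d(2) in simp)
qed

lemma approx_selection_stable:
  assumes "approx_selection K F Z S \<epsilon> u" "z \<in> Z"
  obtains N where "finite N" "\<And>t. t \<in> {0..S} - N \<Longrightarrow> locally_constant_at Z S u z t"
proof -
  obtain N where N: "finite N" "\<forall>t\<in>{0..S} - N. locally_constant_at Z S u z t"
    using assms(1)[unfolded approx_selection_def, THEN conjunct2, THEN conjunct2, rule_format, OF assms(2)]
    by (elim exE conjE)
  show thesis by (rule that[OF N(1)]) (use N(2) in simp)
qed

text \<open>The net is enumerated by naturals so that a first suitable centre can later be picked
  with \<open>LEAST\<close>.\<close>

lemma finite_net:
  fixes C :: "'a::metric_space set"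
  assumes "compact C" "r > 0"
  shows "\<exists>(c :: nat \<Rightarrow> 'a) m. (\<forall>i<m. c i \<in> C) \<and> (\<forall>x\<in>C. \<exists>i<m. dist x (c i) < r)"
proof -
  obtain k where k: "finite k" "k \<subseteq> C" "C \<subseteq> (\<Union>x\<in>k. ball x r)"
    using compact_imp_seq_compact[OF assms(1)] seq_compact_imp_totally_bounded assms(2) by metis
  obtain c where c: "bij_betw c {0..<card k} k" using ex_bij_betw_nat_finite[OF k(1)] by blast
  show ?thesis
  proof (rule exI[of _ c], rule exI[of _ "card k"], intro conjI ballI allI impI)
    show "c i \<in> C" if "i < card k" for i using bij_betwE[OF c] k(2) that by auto
  next
    fix x assume "x \<in> C"
    then obtain y where "y \<in> k" "dist y x < r" using k(3) by auto
    then show "\<exists>i<card k. dist x (c i) < r" using c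
      by (metis atLeastLessThan_iff bij_betw_imp_surj_on dist_commute imageE)
  qed
qed

text \<open>Thresholding the distance to the finitely many centres at a level growing with the time since
  the last grid point makes the choice of a centre stable for all but finitely many times, whatever
  the path is.\<close>

lemma approx_selection_refine:
  fixes K :: "(real \<times> 'a::metric_space) set" and F :: "real \<times> 'a \<Rightarrow> 'b::metric_space set"
  assumes lsc: "lower_semicontinuous_on \<Omega> F" and K: "compact K" "K \<subseteq> \<Omega>"
    and ZK: "\<And>z t. z \<in> Z \<Longrightarrow> t \<in> {0..S} \<Longrightarrow> (t, z t) \<in> K"
    and equi: "\<And>e. e > 0 \<Longrightarrow> \<exists>d>0. \<forall>z\<in>Z. \<forall>s\<in>{0..S}. \<forall>t\<in>{0..S}. \<bar>t - s\<bar> < d \<longrightarrow> dist (z s) (z t) < e"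
    and u: "approx_selection K F Z S \<epsilon> u" and eps: "\<epsilon> > 0" "\<epsilon>' > 0"
  shows "\<exists>u'. approx_selection K F Z S \<epsilon>' u' \<and> (\<forall>z\<in>Z. \<forall>t\<in>{0..S}. dist (u' z t) (u z t) < 2 * \<epsilon>)"
proof -
  obtain W where W: "finite W" "\<And>z t. z \<in> Z \<Longrightarrow> t \<in> {0..S} \<Longrightarrow> u z t \<in> W"
    using u by (rule approx_selection_range) blast
  obtain \<delta> where \<delta>: "\<delta> > 0"
    "\<And>z t q. z \<in> Z \<Longrightarrow> t \<in> {0..S} \<Longrightarrow> q \<in> K \<Longrightarrow> dist q (t, z t) < \<delta> \<Longrightarrow> F q \<inter> ball (u z t) \<epsilon> \<noteq> {}"
    using u by (rule approx_selection_margin) blast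
  \<comment> \<open>The graph of the selection records the old value next to the point, so that a
    value chosen for a whole patch of the graph stays close to the old value throughout the
    patch.\<close>
  define D where "D = {((t, z t), u z t) | z t. z \<in> Z \<and> t \<in> {0..S}}"
  define C where "C = closure D"
  have DK: "D \<subseteq> K \<times> W" unfolding D_def using ZK W by auto
  have cKW: "compact (K \<times> W)" using K(1) W(1) by (simp add: compact_Times finite_imp_compact)
  then have CK: "C \<subseteq> K \<times> W"
    unfolding C_def using DK by (simp add: closure_minimal compact_imp_closed)
  have cC: "compact C"
    using compact_Int_closed[OF cKW, of C] CK by (simp add: C_def inf.absorb2)
  \<comment> \<open>One value \<open>y\<close> serves the whole patch \<open>P\<close>: it is
    \<epsilon>'-close to \<open>F q\<close> for every \<open>q\<close> occurring in \<open>P\<close>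
    and within \<open>2 * \<epsilon>\<close> of every old value recorded there.\<close>
  define good where "good y P \<longleftrightarrow> open P \<and> (\<forall>(q, w)\<in>P. dist y w < 2 * \<epsilon> \<and> (q \<in> K \<longrightarrow> F q \<inter> ball y \<epsilon>' \<noteq> {}))"
    for y :: 'b and P :: "((real \<times> 'a) \<times> 'b) set"
  \<comment> \<open>The point \<open>p\<close> is only a limit of graph points, and the margin
    \<delta> provides \<open>y\<close> in \<open>F p\<close> near \<open>u z t\<close>. One
    \<epsilon> is spent on this choice and one on passing from \<open>u z t\<close> to the limit
    value \<open>w\<close>.\<close>
  have cover: "\<exists>y P. good y P \<and> x \<in> P" if x: "x \<in> C" for x
  proof -
    obtain p w where xpw: "x = (p, w)" by fastforce
    have pK: "p \<in> K" using CK x xpw by auto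
    obtain x' where x': "x' \<in> D" "dist x' x < min \<delta> \<epsilon>"
      using x[unfolded C_def closure_approachable, rule_format, of "min \<delta> \<epsilon>"] \<delta>(1) eps(1) by auto
    then obtain z t where zt: "z \<in> Z" "t \<in> {0..S}" "x' = ((t, z t), u z t)" unfolding D_def by blast
    have d1: "dist p (t, z t) < \<delta>" 
      using x'(2) zt(3) xpw dist_fst_le[of x' x] by (simp add: dist_commute)
    have d2: "dist (u z t) w < \<epsilon>" 
      using x'(2) zt(3) xpw dist_snd_le[of x' x] by (simp add: dist_commute)
    obtain y where y: "y \<in> F p" "dist (u z t) y < \<epsilon>" using \<delta>(2)[OF zt(1,2) pK d1] by auto
    have yw: "dist y w < 2 * \<epsilon>" using y(2) d2 by metric
    obtain U where U: "openin (top_of_set \<Omega>) U" "p \<in> U" "\<And>q. q \<in> U \<Longrightarrow> F q \<inter> ball y \<epsilon>' \<noteq> {}"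
    proof -
      have "p \<in> \<Omega>" "open (ball y \<epsilon>') \<and> y \<in> ball y \<epsilon>'" using pK K(2) eps(2) by auto
      then have "\<exists>U. openin (top_of_set \<Omega>) U \<and> p \<in> U \<and> (\<forall>q\<in>U. F q \<inter> ball y \<epsilon>' \<noteq> {})"
        using lsc[unfolded lower_semicontinuous_on_def, rule_format, OF _ y(1)] by simp
      then show thesis by (elim exE conjE) (rule that, auto)
    qed
    obtain O' where O': "open O'" "U = \<Omega> \<inter> O'" using U(1) unfolding openin_open by blast
    have "good y (O' \<times> ball y (2 * \<epsilon>))"
      unfolding good_def
    proof (intro conjI ballI)
      show "open (O' \<times> ball y (2 * \<epsilon>))" using O'(1) by (simp add: open_Times)
      fix x' assume x': "x' \<in> O' \<times> ball y (2 * \<epsilon>)"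
      obtain q w where [simp]: "x' = (q, w)" by fastforce
      have "F q \<inter> ball y \<epsilon>' \<noteq> {}" if "q \<in> K"
        by (rule U(3)) (use that x' K(2) O'(2) in auto)
      then show "case x' of (q, w) \<Rightarrow> dist y w < 2 * \<epsilon> \<and> (q \<in> K \<longrightarrow> F q \<inter> ball y \<epsilon>' \<noteq> {})"
        using x' by auto
    qed
    moreover have "x \<in> O' \<times> ball y (2 * \<epsilon>)" using xpw U(2) O'(2) yw by (simp add: dist_commute)
    ultimately show ?thesis by blast
  qed
  obtain e where e: "e > 0" "\<And>x. x \<in> C \<Longrightarrow> \<exists>P\<in>{P. \<exists>y. good y P}. ball x e \<subseteq> P"
  proof (rule Heine_Borel_lemma[OF cC, of "{P. \<exists>y. good y P}"])
    show "C \<subseteq> \<Union> {P. \<exists>y. good y P}" using cover by blast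
    show "open P" if "P \<in> {P. \<exists>y. good y P}" for P using that by (auto simp: good_def)
  qed blast
  \<comment> \<open>Budget for the Lebesgue number \<open>e\<close>: at most \<open>3 * r\<close>
    for the threshold, \<open>r\<close> for going from the grid time to the current time, and
    \<open>r\<close> for the margin of the new selection.\<close>
  define r where "r = e / 5"
  have r: "r > 0" using e by (simp add: r_def)
  obtain c :: "nat \<Rightarrow> (real \<times> 'a) \<times> 'b" and m :: nat where
    cm': "\<forall>i<m. c i \<in> C" "\<forall>x\<in>C. \<exists>i<m. dist x (c i) < r"
    using finite_net[OF cC r] by (elim exE conjE)
  have cm: "\<And>i. i < m \<Longrightarrow> c i \<in> C" "\<And>x. x \<in> C \<Longrightarrow> \<exists>i<m. dist x (c i) < r"
    using cm' by simp_all
  have "\<forall>i. \<exists>y. i < m \<longrightarrow> (\<forall>q w. dist (q, w) (c i) < e \<longrightarrow> dist y w < 2 * \<epsilon> \<and> (q \<in> K \<longrightarrow> F q \<inter> ball y \<epsilon>' \<noteq> {}))"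
  proof
    fix i
    show "\<exists>y. i < m \<longrightarrow> (\<forall>q w. dist (q, w) (c i) < e \<longrightarrow> dist y w < 2 * \<epsilon> \<and> (q \<in> K \<longrightarrow> F q \<inter> ball y \<epsilon>' \<noteq> {}))"
    proof (cases "i < m")
      case True
      obtain P y where P: "good y P" "ball (c i) e \<subseteq> P" using e(2)[OF cm(1)[OF True]] by blast
      have "dist y w < 2 * \<epsilon> \<and> (q \<in> K \<longrightarrow> F q \<inter> ball y \<epsilon>' \<noteq> {})" if "dist (q, w) (c i) < e" for q w
      proof -
        have "(q, w) \<in> P" using that P(2) by (auto simp: dist_commute)
        then show ?thesis using P(1) unfolding good_def by blast
      qed
      then show ?thesis by blast
    qed simp
  qed
  from choice[OF this] obtain y where y':
    "\<forall>i. i < m \<longrightarrow> (\<forall>q w. dist (q, w) (c i) < e \<longrightarrow> dist (y i) w < 2 * \<epsilon> \<and> (q \<in> K \<longrightarrow> F q \<inter> ball (y i) \<epsilon>' \<noteq> {}))"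
    by (elim exE)
  have y: "dist (y i) w < 2 * \<epsilon>" "q \<in> K \<Longrightarrow> F q \<inter> ball (y i) \<epsilon>' \<noteq> {}"
    if "i < m" "dist (q, w) (c i) < e" for i q w
    using y'[rule_format, OF that] by auto
  obtain d where d: "d > 0"
    "\<And>z s t. z \<in> Z \<Longrightarrow> s \<in> {0..S} \<Longrightarrow> t \<in> {0..S} \<Longrightarrow> \<bar>t - s\<bar> < d \<Longrightarrow> dist (z s) (z t) < r / 2"
  proof -
    obtain d where "d > 0" "\<forall>z\<in>Z. \<forall>s\<in>{0..S}. \<forall>t\<in>{0..S}. \<bar>t - s\<bar> < d \<longrightarrow> dist (z s) (z t) < r / 2"
      using equi[of "r / 2"] r by auto
    then show thesis using that by simp
  qed
  \<comment> \<open>Within one cell both the time and every path of the class move by less than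
    \<open>r / 2\<close>.\<close>
  define h where "h = min d (r / 2) / 2"
  have h: "h > 0" "h < d" "h < r / 2" using d(1) r by (auto simp: h_def)
  define \<tau> where "\<tau> t = real_of_int \<lfloor>t / h\<rfloor> * h" for t
  have \<tau>: "0 \<le> \<tau> t" "\<tau> t \<le> t" "t - \<tau> t < h" if "t \<ge> 0" for t
    using floor_grid[OF h(1) that] by (simp_all add: \<tau>_def)
  \<comment> \<open>The level climbs linearly from \<open>2 * r\<close> to \<open>3 * r\<close>
    across each cell. The start \<open>2 * r\<close> guarantees that some centre always qualifies;
    the cap \<open>3 * r\<close> keeps the chosen centre within \<open>4 * r\<close> of the current
    graph point.\<close>
  define lev where "lev t = r * (2 + (t / h - real_of_int \<lfloor>t / h\<rfloor>))" for t
  have lev: "2 * r \<le> lev t" "lev t \<le> 3 * r" for t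
  proof -
    have "0 \<le> t / h - real_of_int \<lfloor>t / h\<rfloor>" "t / h - real_of_int \<lfloor>t / h\<rfloor> \<le> 1" by linarith+
    then have "r * 2 \<le> lev t" "lev t \<le> r * 3" unfolding lev_def using r by (intro mult_left_mono; simp)+
    then show "2 * r \<le> lev t" "lev t \<le> 3 * r" by simp_all
  qed
  \<comment> \<open>The path enters only through its value at the grid time \<open>\<tau> t\<close>;
    the old value \<open>u z t\<close> is the sole other ingredient that may change inside a
    cell.\<close>
  define B where "B z t i \<longleftrightarrow> i < m \<and> dist ((\<tau> t, z (\<tau> t)), u z t) (c i) < lev t" for z t i
  define I where "I z t = (LEAST i. B z t i)" for z t
  define u' where "u' z t = y (I z t)" for z t
  have near: "dist ((\<tau> t, z (\<tau> t)), u z t) ((t, z t), u z t) < r" if "z \<in> Z" "t \<in> {0..S}" for z t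
  proof -
    have "\<tau> t \<in> {0..S}" "\<bar>t - \<tau> t\<bar> < h" using \<tau>[of t] that by auto
    then have "dist (z (\<tau> t)) (z t) < r / 2" "dist (\<tau> t) t < r / 2"
      using d(2)[OF that(1), of "\<tau> t" t] that h by (auto simp: dist_real_def abs_minus_commute)
    moreover have "dist ((\<tau> t, z (\<tau> t)), u z t) ((t, z t), u z t) \<le> dist (\<tau> t) t + dist (z (\<tau> t)) (z t)"
      by (simp add: dist_Pair_Pair sqrt_sum_squares_le_sum)
    ultimately show ?thesis by linarith
  qed
  have BI: "B z t (I z t)" if "z \<in> Z" "t \<in> {0..S}" for z t
  proof -
    have "((t, z t), u z t) \<in> C" unfolding C_def using that closure_subset[of D] by (auto simp: D_def)
    then obtain i where "i < m" "dist ((t, z t), u z t) (c i) < r" using cm(2) by blast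
    then have "B z t i" unfolding B_def using near[OF that] lev(1)[of t]
        dist_triangle[of "((\<tau> t, z (\<tau> t)), u z t)" "c i" "((t, z t), u z t)"] by linarith
    then show ?thesis unfolding I_def by (rule LeastI)
  qed
  have close: "dist ((t, z t), u z t) (c (I z t)) < 4 * r" "I z t < m" if "z \<in> Z" "t \<in> {0..S}" for z t
    using BI[OF that] near[OF that] lev(2)[of t]
      dist_triangle3[of "((t, z t), u z t)" "c (I z t)" "((\<tau> t, z (\<tau> t)), u z t)"]
    unfolding B_def by linarith+
  show ?thesis
  proof (intro exI[of _ u'] conjI ballI)
    show "dist (u' z t) (u z t) < 2 * \<epsilon>" if "z \<in> Z" "t \<in> {0..S}" for z t
      unfolding u'_def
      by (rule y(1)[of _ "(t, z t)"]) (use close[OF that] r in \<open>auto simp: r_def\<close>)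
    show "approx_selection K F Z S \<epsilon>' u'"
      unfolding approx_selection_def
    proof (intro conjI)
      show "\<exists>W. finite W \<and> (\<forall>z\<in>Z. \<forall>t\<in>{0..S}. u' z t \<in> W)"
        by (rule exI[of _ "y ` {..<m}"]) (auto simp: u'_def close)
      have "F q \<inter> ball (u' z t) \<epsilon>' \<noteq> {}"
        if "z \<in> Z" "t \<in> {0..S}" "q \<in> K" "dist q (t, z t) < r" for z t q
        unfolding u'_def
      proof (rule y(2)[of _ q "u z t"])
        have "dist (q, u z t) ((t, z t), u z t) < r" using that(4) by (simp add: dist_Pair_Pair)
        then show "dist (q, u z t) (c (I z t)) < e"
          using close(1)[OF that(1,2)] dist_triangle[of "(q, u z t)" "c (I z t)" "((t, z t), u z t)"]
          unfolding r_def by linarith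
      qed (use that close in auto)
      then show "\<exists>\<delta>>0. \<forall>z\<in>Z. \<forall>t\<in>{0..S}. \<forall>q\<in>K. dist q (t, z t) < \<delta> \<longrightarrow> F q \<inter> ball (u' z t) \<epsilon>' \<noteq> {}"
        using r by blast
      show "\<forall>z\<in>Z. \<exists>N. finite N \<and> (\<forall>t\<in>{0..S} - N. locally_constant_at Z S u' z t)"
      proof
        fix z assume z: "z \<in> Z"
        obtain N where N: "finite N" "\<And>t. t \<in> {0..S} - N \<Longrightarrow> locally_constant_at Z S u z t"
          using u z by (rule approx_selection_stable) blast
        define J where "J = {0..\<lfloor>S / h\<rfloor>}"
        \<comment> \<open>This is the solution \<open>t\<close> of
          \<open>dist ... (c i) = lev t\<close> in cell \<open>j\<close> when the old value is
          \<open>w\<close>. Solutions falling outside the cell merely enlarge the finite exceptional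
          set.\<close>
        define g where "g = (\<lambda>(j, i, w). real_of_int j * h + 
            (dist ((real_of_int j * h, z (real_of_int j * h)), w) (c i) / r - 2) * h)"
        define N' where "N' = N \<union> (\<lambda>j. real_of_int j * h) ` J \<union> g ` (J \<times> {..<m} \<times> W)"
        have "finite N'" unfolding N'_def J_def using N(1) W(1) by auto
        moreover have "locally_constant_at Z S u' z t" if t: "t \<in> {0..S} - N'" for t
        proof -
          have tS: "t \<in> {0..S}" "t \<in> {0..S} - N" using t unfolding N'_def by auto
          have floorJ: "\<lfloor>t / h\<rfloor> \<in> J"
            unfolding J_def using tS h by (auto simp: divide_right_mono floor_mono)
          have nint: "t / h \<notin> \<int>"
          proof
            assume "t / h \<in> \<int>"
            then obtain j where "t / h = real_of_int j" by (auto elim: Ints_cases)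
            then have "t = real_of_int \<lfloor>t / h\<rfloor> * h" using h by (metis floor_of_int less_irrefl nonzero_eq_divide_eq)
            then show False using t floorJ unfolding N'_def by blast
          qed
          \<comment> \<open>Without a tie, every comparison with the level survives small
            perturbations of the time and of the path, and so does the least index passing
            it.\<close>
          have neq: "dist ((\<tau> t, z (\<tau> t)), u z t) (c i) \<noteq> lev t" if "i < m" for i
          proof
            assume "dist ((\<tau> t, z (\<tau> t)), u z t) (c i) = lev t"
            then have "g (\<lfloor>t / h\<rfloor>, i, u z t) = \<tau> t + (lev t / r - 2) * h"
              unfolding g_def \<tau>_def by simp
            also have "lev t / r - 2 = t / h - real_of_int \<lfloor>t / h\<rfloor>" unfolding lev_def using r by simp
            also have "\<tau> t + (t / h - real_of_int \<lfloor>t / h\<rfloor>) * h = t"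
              unfolding \<tau>_def using h by (simp add: left_diff_distrib)
            finally have "g (\<lfloor>t / h\<rfloor>, i, u z t) = t" .
            moreover have "(\<lfloor>t / h\<rfloor>, i, u z t) \<in> J \<times> {..<m} \<times> W" using floorJ that W(2)[OF z tS(1)] by simp
            ultimately have "t \<in> g ` (J \<times> {..<m} \<times> W)" by (metis imageI)
            then show False using t unfolding N'_def by simp
          qed
          have lc: "locally_constant_at Z S u z t" by (rule N(2)[OF tS(2)])
          show ?thesis unfolding locally_constant_at_def
          proof (intro conjI allI impI)
            have ts: "((\<lambda>s. s / h) \<longlongrightarrow> t / h) (at t within {0..S})"
              using h by (intro tendsto_intros) auto
            have e1: "\<forall>\<^sub>F s in at t within {0..S}. \<lfloor>s / h\<rfloor> = \<lfloor>t / h\<rfloor>"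
              by (rule eventually_floor_eq[OF ts nint])
            have e2: "\<forall>\<^sub>F s in at t within {0..S}. u z s = u z t"
              using lc unfolding locally_constant_at_def by blast
            have "((\<lambda>s. r * (2 + (s / h - real_of_int \<lfloor>t / h\<rfloor>))) \<longlongrightarrow> lev t) (at t within {0..S})"
              unfolding lev_def using h by (intro tendsto_intros) auto
            then have "\<forall>\<^sub>F s in at t within {0..S}. dist ((\<tau> t, z (\<tau> t)), u z t) (c i) < r * (2 + (s / h - real_of_int \<lfloor>t / h\<rfloor>))
               \<longleftrightarrow> dist ((\<tau> t, z (\<tau> t)), u z t) (c i) < lev t" if "i < m" for i
              by (rule eventually_less_iff_of_tendsto[OF tendsto_const _ neq[OF that]])
            then have e3: "\<forall>\<^sub>F s in at t within {0..S}. \<forall>i\<in>{..<m}. dist ((\<tau> t, z (\<tau> t)), u z t) (c i) < r * (2 + (s / h - real_of_int \<lfloor>t / h\<rfloor>))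
               \<longleftrightarrow> dist ((\<tau> t, z (\<tau> t)), u z t) (c i) < lev t"
              by (intro eventually_ball_finite) auto
            show "\<forall>\<^sub>F s in at t within {0..S}. u' z s = u' z t"
              using e1 e2 e3
            proof eventually_elim
              case (elim s)
              have "\<tau> s = \<tau> t" unfolding \<tau>_def elim(1) by simp
              then have "B z s = B z t" unfolding B_def
                using elim by (auto simp: fun_eq_iff lev_def)
              then show ?case by (simp add: u'_def I_def)
            qed
          next
            fix zs :: "nat \<Rightarrow> real \<Rightarrow> 'a"
            assume zs: "range zs \<subseteq> Z" "converges_before zs z t"
            have e2: "\<forall>\<^sub>F k in sequentially. u (zs k) t = u z t"
              using lc zs unfolding locally_constant_at_def by blast
            \<comment> \<open>The grid time does not exceed \<open>t\<close>, so convergence on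
              \<open>[0, t]\<close> is enough: no knowledge of the future is used.\<close>
            have "(\<lambda>k. zs k (\<tau> t)) \<longlonglongrightarrow> z (\<tau> t)"
              using zs(2) \<tau>[of t] tS unfolding converges_before_def by auto
            then have "(\<lambda>k. dist ((\<tau> t, zs k (\<tau> t)), u z t) (c i)) \<longlonglongrightarrow> dist ((\<tau> t, z (\<tau> t)), u z t) (c i)" for i
              by (intro tendsto_intros)
            then have "\<forall>\<^sub>F k in sequentially. dist ((\<tau> t, zs k (\<tau> t)), u z t) (c i) < lev t
               \<longleftrightarrow> dist ((\<tau> t, z (\<tau> t)), u z t) (c i) < lev t" if "i < m" for i
              by (rule eventually_less_iff_of_tendsto[OF _ tendsto_const neq[OF that]])
            then have e3: "\<forall>\<^sub>F k in sequentially. \<forall>i\<in>{..<m}. dist ((\<tau> t, zs k (\<tau> t)), u z t) (c i) < lev t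
               \<longleftrightarrow> dist ((\<tau> t, z (\<tau> t)), u z t) (c i) < lev t"
              by (intro eventually_ball_finite) auto
            show "\<forall>\<^sub>F k in sequentially. u' (zs k) t = u' z t"
              using e2 e3
            proof eventually_elim
              case (elim k)
              then have "B (zs k) t = B z t" unfolding B_def
                by (auto simp: fun_eq_iff)
              then show ?case by (simp add: u'_def I_def)
            qed
          qed
        qed
        ultimately show "\<exists>N. finite N \<and> (\<forall>t\<in>{0..S} - N. locally_constant_at Z S u' z t)" by blast
      qed
    qed
  qed
qed

section \<open>Limits of the successive refinements\<close>

lemma geometric_limit:
  fixes x :: "nat \<Rightarrow> 'a::complete_space"
  assumes x: "\<And>n. dist (x (Suc n)) (x n) \<le> C * (1/2)^n" and C: "C \<ge> 0"
  obtains l where "\<And>n. dist (x n) l \<le> 2 * C * (1/2)^n"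
proof -
  \<comment> \<open>The factor \<open>1 - (1/2)^k\<close> keeps the exact partial geometric sum,
    which makes the induction close.\<close>
  have step: "dist (x n) (x (n + k)) \<le> 2 * C * (1/2)^n * (1 - (1/2)^k)" for n k
  proof (induction k)
    case (Suc k)
    have "dist (x n) (x (n + Suc k)) \<le> dist (x n) (x (n + k)) + dist (x (Suc (n + k))) (x (n + k))"
      using dist_triangle2[of "x n" "x (n + Suc k)" "x (n + k)"] by simp
    also have "\<dots> \<le> 2 * C * (1/2)^n * (1 - (1/2)^k) + C * (1/2)^(n + k)"
      using Suc x[of "n + k"] by linarith
    also have "\<dots> = 2 * C * (1/2)^n * (1 - (1/2)^Suc k)" by (simp add: power_add algebra_simps)
    finally show ?case .
  qed simp
  have bound: "dist (x n) (x (n + k)) \<le> 2 * C * (1/2)^n" for n k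
  proof -
    have "2 * C * (1/2)^n * (1 - (1/2)^k) \<le> 2 * C * (1/2)^n * 1"
      using C by (intro mult_left_mono) auto
    then show ?thesis using step[of n k] by simp
  qed
  have lim0: "(\<lambda>n. 2 * C * (1/2::real)^n) \<longlonglongrightarrow> 0"
    using tendsto_mult_right_zero[OF LIMSEQ_realpow_zero[of "1/2"]] by simp
  have "Cauchy x"
  proof (rule CauchyI')
    fix e :: real assume "e > 0"
    then have "\<forall>\<^sub>F n in sequentially. 2 * C * (1/2)^n < e" by (rule order_tendstoD(2)[OF lim0])
    then obtain M where M: "\<And>n. n \<ge> M \<Longrightarrow> 2 * C * (1/2)^n < e" by (auto simp: eventually_sequentially)
    show "\<exists>M. \<forall>m\<ge>M. \<forall>n>m. dist (x m) (x n) < e"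
    proof (intro exI allI impI)
      fix m n assume "m \<ge> M" "n > m"
      then show "dist (x m) (x n) < e" using bound[of m "n - m"] M[of m] by simp
    qed
  qed
  then obtain l where l: "x \<longlonglongrightarrow> l" using Cauchy_convergent convergent_def by blast
  have "dist (x n) l \<le> 2 * C * (1/2)^n" for n
  proof (rule LIMSEQ_le_const2)
    show "(\<lambda>k. dist (x n) (x (k + n))) \<longlonglongrightarrow> dist (x n) l"
      by (intro tendsto_intros LIMSEQ_ignore_initial_segment l)
    show "\<exists>N. \<forall>k\<ge>N. dist (x n) (x (k + n)) \<le> 2 * C * (1/2)^n" using bound[of n] by (simp add: add.commute)
  qed
  then show thesis by (rule that)
qed

text \<open>An interchange of limits: each approximant is eventually constant, and the error
  \<open>c n\<close> is uniform in the argument. The filter is arbitrary because the result serves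
  both for convergence in time and for convergence of paths.\<close>

lemma tendsto_of_uniform_approx:
  assumes c: "c \<longlonglongrightarrow> (0::real)"
    and ev: "\<And>n::nat. \<forall>\<^sub>F x in Fl. f n x = a n"
    and app: "\<And>n. \<forall>\<^sub>F x in Fl. dist (f n x) (g x) \<le> c n" "\<And>n. dist (a n) l \<le> c n"
  shows "(g \<longlongrightarrow> l) Fl"
proof (rule tendstoI)
  fix e :: real assume "e > 0"
  then have "\<forall>\<^sub>F n in sequentially. c n < e / 2" using order_tendstoD(2)[OF c, of "e/2"] by simp
  then obtain n where n: "c n < e / 2" by (auto simp: eventually_sequentially)
  show "\<forall>\<^sub>F x in Fl. dist (g x) l < e"
    using ev[of n] app(1)[of n]
  proof eventually_elim
    case (elim x)
    then show ?case using app(2)[of n] n dist_triangle3[of "g x" l "a n"] by simp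
  qed
qed

text \<open>This is what remains of \<open>locally_constant_at\<close> after a uniform limit of
  selections.\<close>

definition stable_at ::
  "(real \<Rightarrow> 'a::topological_space) set \<Rightarrow> real \<Rightarrow> ((real \<Rightarrow> 'a) \<Rightarrow> real \<Rightarrow> 'b::topological_space) \<Rightarrow> (real \<Rightarrow> 'a) \<Rightarrow> real \<Rightarrow> bool" where
  "stable_at Z S u z t \<longleftrightarrow>
     continuous (at t within {0..S}) (u z) \<and>
     (\<forall>zs. range zs \<subseteq> Z \<longrightarrow> converges_before zs z t \<longrightarrow> (\<lambda>m. u (zs m) t) \<longlonglongrightarrow> u z t)"

text \<open>The corrections are summable, so the refinements converge uniformly; their distance to
  the closed set \<open>F (t, z t)\<close> tends to zero, which puts the limit into it. The
  exceptional times of a path form a union of countably many finite sets.\<close>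

theorem path_dependent_selection:
  fixes K :: "(real \<times> 'a::metric_space) set" and F :: "real \<times> 'a \<Rightarrow> 'b::banach set"
  assumes lsc: "lower_semicontinuous_on \<Omega> F" and K: "compact K" "K \<subseteq> \<Omega>"
    and F: "\<And>p. p \<in> K \<Longrightarrow> closed (F p) \<and> F p \<noteq> {}"
    and L: "L \<ge> 0" "\<And>p w. p \<in> K \<Longrightarrow> w \<in> F p \<Longrightarrow> norm w \<le> L"
    and ZK: "\<And>z t. z \<in> Z \<Longrightarrow> t \<in> {0..S} \<Longrightarrow> (t, z t) \<in> K"
    and equi: "\<And>e. e > 0 \<Longrightarrow> \<exists>d>0. \<forall>z\<in>Z. \<forall>s\<in>{0..S}. \<forall>t\<in>{0..S}. \<bar>t - s\<bar> < d \<longrightarrow> dist (z s) (z t) < e"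
  shows "\<exists>u. (\<forall>z\<in>Z. \<forall>t\<in>{0..S}. u z t \<in> F (t, z t)) \<and>
      (\<forall>z\<in>Z. \<exists>N. countable N \<and> (\<forall>t\<in>{0..S} - N. stable_at Z S u z t))"
proof -
  \<comment> \<open>At radius \<open>L + 1\<close> the zero map is an approximate selection, since
    the values on \<open>K\<close> have norm at most \<open>L\<close>; this starts the
    recursion.\<close>
  define e where "e n = (L + 1) * (1/2)^n" for n :: nat
  have e: "e n > 0" for n using L by (simp add: e_def)
  have "\<exists>U. \<forall>n. approx_selection K F Z S (e n) (U n) \<and> 
     (\<forall>z\<in>Z. \<forall>t\<in>{0..S}. dist (U (Suc n) z t) (U n z t) < 2 * e n)"
  proof (rule dependent_nat_choice)
    have "F q \<inter> ball 0 (L + 1) \<noteq> {}" if "q \<in> K" for q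
      using F[OF that] L(2)[OF that] by fastforce
    then have "\<exists>\<delta>>0. \<forall>z\<in>Z. \<forall>t\<in>{0..S}. \<forall>q\<in>K. dist q (t, z t) < \<delta> \<longrightarrow> F q \<inter> ball 0 (L + 1) \<noteq> {}"
      by (intro exI[of _ 1]) simp
    moreover have "\<exists>W. finite W \<and> (\<forall>z\<in>Z. \<forall>t\<in>{0..S}. (0::'b) \<in> W)" by (intro exI[of _ "{0}"]) simp
    moreover have "\<exists>N. finite N \<and> (\<forall>t\<in>{0..S} - N. locally_constant_at Z S (\<lambda>_ _. 0::'b) z t)" for z
      by (intro exI[of _ "{}"]) (simp add: locally_constant_at_def)
    ultimately have "approx_selection K F Z S (e 0) (\<lambda>_ _. 0)"
      unfolding approx_selection_def e_def by simp
    then show "\<exists>u. approx_selection K F Z S (e 0) u" by blast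
    fix u n assume u: "approx_selection K F Z S (e n) u"
    show "\<exists>u'. approx_selection K F Z S (e (Suc n)) u' \<and> 
      (\<forall>z\<in>Z. \<forall>t\<in>{0..S}. dist (u' z t) (u z t) < 2 * e n)"
      by (rule approx_selection_refine[OF lsc K _ _ u e e]) (use ZK equi in auto)
  qed
  then obtain U where U: "\<And>n. approx_selection K F Z S (e n) (U n)"
    "\<And>n z t. z \<in> Z \<Longrightarrow> t \<in> {0..S} \<Longrightarrow> dist (U (Suc n) z t) (U n z t) < 2 * e n" by metis
  \<comment> \<open>The tail of the corrections \<open>2 * e k\<close> over \<open>k\<close> from
    \<open>n\<close> on sums to \<open>4 * e n\<close>.\<close>
  define c where "c n = 4 * e n" for n
  have e0: "e \<longlonglongrightarrow> 0" unfolding e_def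
    using tendsto_mult_right_zero[OF LIMSEQ_realpow_zero[of "1/2"]] by simp
  have c0: "c \<longlonglongrightarrow> 0" unfolding c_def using tendsto_mult_right_zero[OF e0] .
  have "\<exists>l. \<forall>n. dist (U n z t) l \<le> c n" if zt: "z \<in> Z" "t \<in> {0..S}" for z t
  proof -
    obtain l where "\<And>n. dist (U n z t) l \<le> 2 * (2 * (L + 1)) * (1/2)^n"
    proof (rule geometric_limit[of "\<lambda>n. U n z t" "2 * (L + 1)"])
      show "dist (U (Suc n) z t) (U n z t) \<le> 2 * (L + 1) * (1/2)^n" for n
        using less_imp_le[OF U(2)[OF zt, of n]] unfolding e_def mult.assoc .
    qed (use L in auto)
    moreover have "c n = 2 * (2 * (L + 1)) * (1/2)^n" for n by (simp add: c_def e_def)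
    ultimately show ?thesis by metis
  qed
  then obtain u where u: "\<And>z t n. z \<in> Z \<Longrightarrow> t \<in> {0..S} \<Longrightarrow> dist (U n z t) (u z t) \<le> c n" by metis
  have "u z t \<in> F (t, z t)" if zt: "z \<in> Z" "t \<in> {0..S}" for z t
  proof -
    have "\<exists>w\<in>F (t, z t). dist (U n z t) w < e n" for n
    proof -
      obtain \<delta> where \<delta>: "\<delta> > 0" 
        "\<And>z t q. z \<in> Z \<Longrightarrow> t \<in> {0..S} \<Longrightarrow> q \<in> K \<Longrightarrow> dist q (t, z t) < \<delta> \<Longrightarrow> F q \<inter> ball (U n z t) (e n) \<noteq> {}"
        using U(1)[of n] by (rule approx_selection_margin) blast
      then have "F (t, z t) \<inter> ball (U n z t) (e n) \<noteq> {}" using zt ZK by simp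
      then show ?thesis by auto
    qed
    then obtain w where w: "\<And>n. w n \<in> F (t, z t)" "\<And>n. dist (U n z t) (w n) < e n" by metis
    have "w \<longlonglongrightarrow> u z t"
    proof (rule metric_tendsto_imp_tendsto)
      show "(\<lambda>n. e n + c n) \<longlonglongrightarrow> 0" using tendsto_add[OF e0 c0] by simp
      have "dist (w n) (u z t) \<le> dist (e n + c n) 0" for n
        using w(2)[of n] u[OF zt, of n] dist_triangle3[of "w n" "u z t" "U n z t"] by simp
      then show "\<forall>\<^sub>F n in sequentially. dist (w n) (u z t) \<le> dist (e n + c n) 0" by simp
    qed
    moreover have "closed (F (t, z t))" using F[OF ZK[OF zt]] by simp
    ultimately show ?thesis using w(1) closed_sequentially by blast
  qed
  moreover have "\<exists>N. countable N \<and> (\<forall>t\<in>{0..S} - N. stable_at Z S u z t)" if z: "z \<in> Z" for z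
  proof -
    have "\<exists>N. finite N \<and> (\<forall>t\<in>{0..S} - N. locally_constant_at Z S (U n) z t)" for n
      by (rule approx_selection_stable[OF U(1)[of n] z]) blast
    then obtain N where N: "\<And>n. finite (N n)" 
      "\<And>n t. t \<in> {0..S} - N n \<Longrightarrow> locally_constant_at Z S (U n) z t" by metis
    have "stable_at Z S u z t" if t: "t \<in> {0..S} - (\<Union>n. N n)" for t
      unfolding stable_at_def
    proof (intro conjI allI impI)
      have lc: "locally_constant_at Z S (U n) z t" for n using N(2) t by auto
      have tS: "t \<in> {0..S}" using t by simp
      show "continuous (at t within {0..S}) (u z)"
        unfolding continuous_within
      proof (rule tendsto_of_uniform_approx[OF c0])
        show "\<forall>\<^sub>F x in at t within {0..S}. U n z x = U n z t" for n
          using lc[of n] unfolding locally_constant_at_def by simp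
        show "\<forall>\<^sub>F x in at t within {0..S}. dist (U n z x) (u z x) \<le> c n" for n
          using u[OF z] by (simp add: eventually_at_filter)
      qed (use u[OF z tS] in simp)
      fix zs assume zs: "range zs \<subseteq> Z" "converges_before zs z t"
      then have zsZ: "zs m \<in> Z" for m by auto
      show "(\<lambda>m. u (zs m) t) \<longlonglongrightarrow> u z t"
      proof (rule tendsto_of_uniform_approx[OF c0])
        show "\<forall>\<^sub>F m in sequentially. U n (zs m) t = U n z t" for n
          using lc[of n] zs unfolding locally_constant_at_def by simp
        show "\<forall>\<^sub>F m in sequentially. dist (U n (zs m) t) (u (zs m) t) \<le> c n" for n
          using u[OF zsZ tS] by simp
      qed (use u[OF z tS] in simp)
    qed
    then show ?thesis using N(1) by (intro exI[of _ "\<Union>n. N n"]) (auto intro: countable_finite)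
  qed
  ultimately show ?thesis by (intro exI[of _ u]) simp
qed


section \<open>Davie's estimate for the Euler scheme\<close>

text \<open>The interval is split into two halves separated by one grid step, on which \<open>J\<close> vanishes;
  this way both halves have at most half the length, whatever the parity of their number of steps.\<close>

lemma discrete_sewing:
  fixes J :: "nat \<Rightarrow> nat \<Rightarrow> 'b::real_normed_vector"
  assumes "h \<ge> 0" "\<eta> \<ge> 0" "K \<ge> 0" "D \<ge> 0"
    and J0: "\<And>k. J k k = 0" "\<And>k. k < N \<Longrightarrow> J k (Suc k) = 0"
    and defect: "\<And>i l k. i \<le> l \<Longrightarrow> l \<le> k \<Longrightarrow> k \<le> N \<Longrightarrow> norm (J i l) \<le> K * (h * real (l - i)) powr \<eta> \<Longrightarrow>
      norm (J i k - J i l - J l k) \<le> D * (h * real (k - i)) powr \<eta>"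
    and K: "2 powr (1 - \<eta>) * K + 2 * D \<le> K"
  shows "i \<le> k \<Longrightarrow> k \<le> N \<Longrightarrow> norm (J i k) \<le> K * (h * real (k - i)) powr \<eta>"
proof (induction "k - i" arbitrary: i k rule: less_induct)
  case less
  define n where "n = k - i"
  consider "n = 0" | "n = 1" | "n \<ge> 2" by linarith
  then show ?case
  proof cases
    case 1
    then have "k = i" using less.prems by (simp add: n_def)
    then show ?thesis using J0 assms by simp
  next
    case 2
    then have "k = Suc i" using less.prems by (simp add: n_def)
    then show ?thesis using J0 assms less.prems by simp
  next
    case 3
    \<comment> \<open>The halves are \<open>[i, l]\<close> and \<open>[Suc l, k]\<close>; the step
      from \<open>l\<close> to \<open>Suc l\<close> between them is free of error.\<close>
    define l where "l = i + n div 2"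
    have l: "i < l" "Suc l \<le> k" "k - Suc l \<le> n div 2" "l - i = n div 2" "k = i + n"
      using 3 less.prems by (auto simp: l_def n_def)
    have half: "(h * real m) powr \<eta> \<le> 2 powr (- \<eta>) * (h * real n) powr \<eta>" if "m \<le> n div 2" for m
    proof -
      have "real m \<le> real n / 2" using that by linarith
      then have "h * real m \<le> (1/2) * (h * real n)" using mult_left_mono[OF _ assms(1), of "real m" "real n / 2"] by simp
      then have "(h * real m) powr \<eta> \<le> ((1/2) * (h * real n)) powr \<eta>"
        using assms(1,2) by (intro powr_mono2) auto
      also have "\<dots> = (1/2) powr \<eta> * (h * real n) powr \<eta>" by (rule powr_mult)
      also have "(1/2::real) powr \<eta> = 2 powr (- \<eta>)" by (simp only: powr_minus_divide powr_divide powr_one_eq_one)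
      finally show ?thesis .
    qed
    have b1: "norm (J i l) \<le> K * (h * real (l - i)) powr \<eta>"
      by (rule less.hyps) (use l less.prems in auto)
    have b2: "norm (J (Suc l) k) \<le> K * (h * real (k - Suc l)) powr \<eta>"
      by (rule less.hyps) (use l less.prems in auto)
    \<comment> \<open>The defect bound is conditional on the estimate for the left piece, which is
      why \<open>b1\<close> has to be available first.\<close>
    have d1: "norm (J i k - J i l - J l k) \<le> D * (h * real n) powr \<eta>"
      unfolding n_def by (rule defect) (use l less.prems b1 in auto)
    \<comment> \<open>Here the left piece is a single grid step, where \<open>J\<close> vanishes, so
      the condition of \<open>defect\<close> holds trivially.\<close>
    have "norm (J l k - J l (Suc l) - J (Suc l) k) \<le> D * (h * real (k - l)) powr \<eta>"
      by (rule defect) (use l less.prems J0 assms in auto)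
    also have "\<dots> \<le> D * (h * real n) powr \<eta>"
      using assms(1,2,4) l by (intro mult_left_mono powr_mono2) auto
    finally have d2: "norm (J l k - J l (Suc l) - J (Suc l) k) \<le> D * (h * real n) powr \<eta>" .
    have "J i k = J i l + J (Suc l) k + (J i k - J i l - J l k) + (J l k - J l (Suc l) - J (Suc l) k)"
      using J0(2)[of l] l less.prems by simp
    then have "norm (J i k) \<le> norm (J i l) + norm (J (Suc l) k) + norm (J i k - J i l - J l k)
        + norm (J l k - J l (Suc l) - J (Suc l) k)"
      by (metis norm_triangle_mono order_refl)
    also have "\<dots> \<le> K * (2 powr (- \<eta>) * (h * real n) powr \<eta>) + K * (2 powr (- \<eta>) * (h * real n) powr \<eta>)
        + D * (h * real n) powr \<eta> + D * (h * real n) powr \<eta>"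
      using order_trans[OF b1 mult_left_mono[OF half assms(3)]] l(3,4)
        order_trans[OF b2 mult_left_mono[OF half assms(3)]] d1 d2 by (intro add_mono) auto
    \<comment> \<open>Two halves of weight \<open>2 powr (- \<eta>)\<close> each give the factor
      \<open>2 powr (1 - \<eta>)\<close>, a contraction when \<eta> exceeds 1.\<close>
    also have "\<dots> = (2 powr (1 - \<eta>) * K + 2 * D) * (h * real n) powr \<eta>"
      by (simp add: powr_diff powr_minus field_simps)
    also have "\<dots> \<le> K * (h * real n) powr \<eta>" using K by (intro mult_right_mono) auto
    finally show ?thesis by (simp add: n_def)
  qed
qed

text \<open>\<open>Q a s t\<close> stands for the second order term \<open>tensor_apply (DG a o\<^sub>L G a) (XX s t)\<close>.\<close>

locale rough_coefficients =
  fixes \<alpha> \<gamma> T C :: real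
    and X :: "real \<Rightarrow> 'a::real_normed_vector"
    and G :: "'b::euclidean_space \<Rightarrow> 'a \<Rightarrow>\<^sub>L 'b"
    and DG :: "'b \<Rightarrow> 'b \<Rightarrow>\<^sub>L 'a \<Rightarrow>\<^sub>L 'b"
    and Q :: "'b \<Rightarrow> real \<Rightarrow> real \<Rightarrow> 'b"
  assumes \<alpha>: "1/3 < \<alpha>" "\<alpha> \<le> 1/2" and \<gamma>: "0 < \<gamma>" "\<gamma> \<le> 1" and \<alpha>\<gamma>: "\<alpha> * (2 + \<gamma>) > 1" and C: "C \<ge> 1"
    and X: "0 \<le> s \<Longrightarrow> s \<le> t \<Longrightarrow> t \<le> T \<Longrightarrow> norm (X t - X s) \<le> C * (t - s) powr \<alpha>"
    and Q_chen: "0 \<le> r \<Longrightarrow> r \<le> s \<Longrightarrow> s \<le> t \<Longrightarrow> t \<le> T \<Longrightarrow>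
      Q a r t = Q a r s + Q a s t + DG a (G a (X s - X r)) (X t - X s)"
    and Q: "0 \<le> s \<Longrightarrow> s \<le> t \<Longrightarrow> t \<le> T \<Longrightarrow> norm (Q a s t) \<le> C * (t - s) powr (2 * \<alpha>)"
    and Q_diff: "0 \<le> s \<Longrightarrow> s \<le> t \<Longrightarrow> t \<le> T \<Longrightarrow>
      norm (Q b s t - Q a s t) \<le> C * norm (b - a) powr \<gamma> * (t - s) powr (2 * \<alpha>)"
    and G: "norm (G a) \<le> C" and DG: "norm (DG a) \<le> C"
    and G_lip: "norm (G b - G a) \<le> C * norm (b - a)"
    and G_taylor: "norm (G b - G a - DG a (b - a)) \<le> C * norm (b - a) powr (1 + \<gamma>)"
begin

definition \<eta> :: real where "\<eta> = \<alpha> * (2 + \<gamma>)"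

text \<open>The summands bound, in this order, the drift, the first order term, the second order
  term, the Chen cross term arising inside a grid cell, and the absorbed local error.\<close>

definition incr_const :: "real \<Rightarrow> real" where "incr_const L = L + C^2 + C + C^4 + 1"

text \<open>The part of the defect free of \<open>K\<close>: Taylor remainder of \<open>G\<close>,
  drift and second order term fed through \<open>DG\<close>, and the variation of \<open>Q\<close>
  in its base point.\<close>

definition defect_const :: "real \<Rightarrow> real" where
  "defect_const L = C * (C * (incr_const L)^2 + C * L + C^2) + C * incr_const L"

text \<open>Davie's remainder. The drift increment is subtracted exactly, so that a Lipschitz bound
  on \<open>x\<close> is all that is ever asked of it.\<close>

definition germ :: "(real \<Rightarrow> 'b) \<Rightarrow> (real \<Rightarrow> 'b) \<Rightarrow> real \<Rightarrow> real \<Rightarrow> 'b" where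
  "germ z x s t = z t - z s - (x t - x s) - G (z s) (X t - X s) - Q (z s) s t"

section \<open>Local expansions of second order\<close>

lemma \<eta>: "\<eta> > 1" "\<eta> > \<alpha>"
  using \<alpha>\<gamma> \<alpha> unfolding \<eta>_def by linarith+

lemma Q_refl: "0 \<le> s \<Longrightarrow> s \<le> T \<Longrightarrow> Q a s s = 0"
  using Q_chen[of s s s a] by simp

lemma GX: assumes "0 \<le> s" "s \<le> t" "t \<le> T" shows "norm (G a (X t - X s)) \<le> C^2 * (t - s) powr \<alpha>"
proof -
  have "norm (G a (X t - X s)) \<le> norm (G a) * norm (X t - X s)" by (rule norm_blinfun)
  also have "\<dots> \<le> C * (C * (t - s) powr \<alpha>)" using X[OF assms] G C by (intro mult_mono) auto
  finally show ?thesis by (simp add: power2_eq_square)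
qed

lemma powr_le_\<alpha>:
  assumes "0 \<le> d" "d \<le> (1::real)"
  shows "d \<le> d powr \<alpha>" "d powr (2 * \<alpha>) \<le> d powr \<alpha>" "d \<le> d powr (2 * \<alpha>)"
    "d powr (2 * \<alpha>) \<le> d powr (\<alpha> * (1 + \<gamma>))" "d \<le> d powr (\<alpha> * (1 + \<gamma>))"
proof -
  have *: "\<alpha> * (1 + \<gamma>) \<le> \<alpha> * 2" using \<alpha> \<gamma> by (intro mult_left_mono) auto
  have "d powr 1 \<le> d powr \<alpha>" "d powr (2 * \<alpha>) \<le> d powr \<alpha>" "d powr 1 \<le> d powr (2 * \<alpha>)"
    "d powr (2 * \<alpha>) \<le> d powr (\<alpha> * (1 + \<gamma>))" "d powr 1 \<le> d powr (\<alpha> * (1 + \<gamma>))"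
    using \<alpha> \<gamma> assms * by (intro powr_mono'; linarith)+
  then show "d \<le> d powr \<alpha>" "d powr (2 * \<alpha>) \<le> d powr \<alpha>" "d \<le> d powr (2 * \<alpha>)"
    "d powr (2 * \<alpha>) \<le> d powr (\<alpha> * (1 + \<gamma>))" "d \<le> d powr (\<alpha> * (1 + \<gamma>))" using assms by auto
qed

lemma incr_const_ge_1: "L \<ge> 0 \<Longrightarrow> incr_const L \<ge> 1"
  using C by (simp add: incr_const_def add_increasing)

text \<open>The second condition in \<open>J\<close> turns the local error into at most
  \<open>(s - r) powr \<alpha>\<close>, so that the resulting constant does not depend on
  \<open>K\<close>.\<close>

lemma increment_bound:
  assumes "0 \<le> r" "r \<le> s" "s \<le> T" "s - r \<le> 1"
    and x: "norm (x s - x r) \<le> L * (s - r)" "L \<ge> 0"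
    and J: "norm (germ z x r s) \<le> K * (s - r) powr \<eta>" "K * (s - r) powr (\<eta> - \<alpha>) \<le> 1"
  shows "norm (z s - z r) \<le> incr_const L * (s - r) powr \<alpha>"
proof -
  define d where "d = s - r"
  have d: "0 \<le> d" "d \<le> 1" using assms by (auto simp: d_def)
  have "z s - z r = germ z x r s + (x s - x r) + G (z r) (X s - X r) + Q (z r) r s"
    by (simp add: germ_def)
  then have "norm (z s - z r) \<le> norm (germ z x r s) + norm (x s - x r) + norm (G (z r) (X s - X r)) + norm (Q (z r) r s)"
    by (metis norm_triangle_mono order_refl)
  also have "\<dots> \<le> d powr \<alpha> + L * d powr \<alpha> + C^2 * d powr \<alpha> + C * d powr \<alpha>"
  proof (intro add_mono)
    have "K * d powr \<eta> = (K * d powr (\<eta> - \<alpha>)) * d powr \<alpha>" by (simp add: powr_add[symmetric])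
    also have "\<dots> \<le> 1 * d powr \<alpha>" using J(2) unfolding d_def by (intro mult_right_mono) auto
    finally show "norm (germ z x r s) \<le> d powr \<alpha>" using J(1) unfolding d_def by simp
    show "norm (x s - x r) \<le> L * d powr \<alpha>"
      using x mult_left_mono[OF powr_le_\<alpha>(1)[OF d] x(2)] by (simp add: d_def)
    show "norm (G (z r) (X s - X r)) \<le> C^2 * d powr \<alpha>" unfolding d_def by (rule GX) (use assms in auto)
    have "norm (Q (z r) r s) \<le> C * d powr (2 * \<alpha>)" unfolding d_def by (rule Q) (use assms in auto)
    also have "\<dots> \<le> C * d powr \<alpha>" using C powr_le_\<alpha>(2)[OF d] by (intro mult_left_mono) auto
    finally show "norm (Q (z r) r s) \<le> C * d powr \<alpha>" .
  qed
  also have "\<dots> = (L + C^2 + C + 1) * d powr \<alpha>" by (simp add: algebra_simps)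
  also have "\<dots> \<le> incr_const L * d powr \<alpha>" unfolding incr_const_def by (intro mult_right_mono) auto
  finally show ?thesis by (simp add: d_def)
qed

text \<open>Chen's relation contributes \<open>DG (G X)\<close> where the Taylor expansion of
  \<open>G\<close> has \<open>DG\<close> of the increment of \<open>z\<close>. Their difference is
  \<open>DG\<close> applied to everything in that increment beyond first order, the germ over
  \<open>[r, s]\<close> included; this is why the defect bound in the sewing lemma is
  conditional.\<close>

lemma germ_defect:
  assumes "0 \<le> r" "r \<le> s" "s \<le> t" "t \<le> T"
  shows "germ z x r t - germ z x r s - germ z x s t =
    (G (z s) - G (z r) - DG (z r) (z s - z r)) (X t - X s)
    + DG (z r) (germ z x r s + (x s - x r) + Q (z r) r s) (X t - X s) + (Q (z s) s t - Q (z r) s t)"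
proof -
  have 1: "germ z x r s + (x s - x r) + Q (z r) r s = z s - z r - G (z r) (X s - X r)"
    by (simp add: germ_def)
  have 2: "X t - X r = (X t - X s) + (X s - X r)" by simp
  show ?thesis unfolding 1 germ_def Q_chen[OF assms] 2
    by (simp add: blinfun.diff_left blinfun.diff_right blinfun.add_left blinfun.add_right algebra_simps)
qed

text \<open>The contribution of the unknown constant \<open>K\<close> to the defect carries the small factor
  \<open>S powr \<alpha>\<close>, so that the induction of the discrete sewing lemma closes on a short horizon.\<close>

lemma germ_defect_bound:
  assumes rst: "0 \<le> r" "r \<le> s" "s \<le> t" "t \<le> T" "t - r \<le> S" "S \<le> 1" and K: "K \<ge> 0" "K * S powr (\<eta> - \<alpha>) \<le> 1"
    and x: "norm (x s - x r) \<le> L * (s - r)" "L \<ge> 0"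
    and J: "norm (germ z x r s) \<le> K * (s - r) powr \<eta>"
  shows "norm (germ z x r t - germ z x r s - germ z x s t) \<le> (defect_const L + C^2 * S powr \<alpha> * K) * (t - r) powr \<eta>"
proof -
  define d where "d = t - r"
  define M where "M = incr_const L"
  have M: "M \<ge> 1" unfolding M_def by (rule incr_const_ge_1[OF x(2)])
  have d: "0 \<le> d" "d \<le> 1" "s - r \<le> d" "t - s \<le> d" "d \<le> S" using rst by (auto simp: d_def)
  have mono: "(s - r) powr p \<le> d powr p" "(t - s) powr p \<le> d powr p" if "p \<ge> 0" for p
    using that rst d by (auto intro!: powr_mono2)
  have \<eta>0: "\<eta> - \<alpha> \<ge> 0" using \<eta> by simp
  have "K * (s - r) powr (\<eta> - \<alpha>) \<le> K * S powr (\<eta> - \<alpha>)"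
    using K rst \<eta>0 d by (intro mult_left_mono powr_mono2) auto
  then have K': "K * (s - r) powr (\<eta> - \<alpha>) \<le> 1" using K by simp
  have "norm (z s - z r) \<le> M * (s - r) powr \<alpha>"
    unfolding M_def by (rule increment_bound[OF _ _ _ _ x J K']) (use rst d in auto)
  also have "\<dots> \<le> M * d powr \<alpha>" using M mono(1)[of \<alpha>] \<alpha> by (intro mult_left_mono) auto
  finally have z: "norm (z s - z r) \<le> M * d powr \<alpha>" .
  \<comment> \<open>Each of the three contributions to the defect carries powers of \<open>d\<close>
    that add up to at least \<eta>.\<close>
  have p: "d powr (\<alpha> * (1 + \<gamma>)) * d powr \<alpha> = d powr \<eta>" "d powr (\<alpha> * \<gamma>) * d powr (2 * \<alpha>) = d powr \<eta>"
    unfolding powr_add[symmetric] \<eta>_def by (simp_all add: algebra_simps)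
  have Xst: "norm (X t - X s) \<le> C * d powr \<alpha>"
    by (rule order_trans[OF X mult_left_mono[OF mono(2)]]) (use rst C \<alpha> in auto)
  have Mp: "M powr (1 + \<gamma>) \<le> M^2" "M powr \<gamma> \<le> M"
  proof -
    have "M powr (1 + \<gamma>) \<le> M powr 2" "M powr \<gamma> \<le> M powr 1" using M \<gamma> by (intro powr_mono; simp)+
    then show "M powr (1 + \<gamma>) \<le> M^2" "M powr \<gamma> \<le> M" using M by simp_all
  qed
  have a: "norm (G (z s) - G (z r) - DG (z r) (z s - z r)) \<le> C * M^2 * d powr (\<alpha> * (1 + \<gamma>))"
  proof -
    have "norm (G (z s) - G (z r) - DG (z r) (z s - z r)) \<le> C * norm (z s - z r) powr (1 + \<gamma>)" by (rule G_taylor)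
    also have "\<dots> \<le> C * (M * d powr \<alpha>) powr (1 + \<gamma>)" using z C \<gamma> by (intro mult_left_mono powr_mono2) auto
    also have "\<dots> = C * (M powr (1 + \<gamma>) * d powr (\<alpha> * (1 + \<gamma>)))" using M by (simp add: powr_mult powr_powr)
    also have "\<dots> \<le> C * (M^2 * d powr (\<alpha> * (1 + \<gamma>)))" using Mp C by (intro mult_left_mono mult_right_mono) auto
    finally show ?thesis by simp
  qed
  have b: "norm (DG (z r) (germ z x r s + (x s - x r) + Q (z r) r s)) \<le>
      C * (K * d powr \<eta> + (L + C) * d powr (\<alpha> * (1 + \<gamma>)))"
  proof -
    have "norm (germ z x r s + (x s - x r) + Q (z r) r s) \<le> norm (germ z x r s) + norm (x s - x r) + norm (Q (z r) r s)"
      by (metis norm_triangle_mono order_refl)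
    also have "\<dots> \<le> K * d powr \<eta> + L * d powr (\<alpha> * (1 + \<gamma>)) + C * d powr (\<alpha> * (1 + \<gamma>))"
    proof (intro add_mono)
      show "norm (germ z x r s) \<le> K * d powr \<eta>" 
        using J mult_left_mono[OF mono(1)[of \<eta>] K(1)] \<eta> by simp
      have "norm (x s - x r) \<le> L * d" using x mult_left_mono[OF d(3) x(2)] by simp
      then show "norm (x s - x r) \<le> L * d powr (\<alpha> * (1 + \<gamma>))"
        using mult_left_mono[OF powr_le_\<alpha>(5)[OF d(1,2)] x(2)] by simp
      have "norm (Q (z r) r s) \<le> C * (s - r) powr (2 * \<alpha>)" by (rule Q) (use rst in auto)
      also have "\<dots> \<le> C * d powr (2 * \<alpha>)" using C \<alpha> mono(1)[of "2 * \<alpha>"] by (intro mult_left_mono) auto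
      also have "\<dots> \<le> C * d powr (\<alpha> * (1 + \<gamma>))" using C powr_le_\<alpha>(4)[OF d(1,2)] by (intro mult_left_mono) auto
      finally show "norm (Q (z r) r s) \<le> C * d powr (\<alpha> * (1 + \<gamma>))" .
    qed
    also have "\<dots> = K * d powr \<eta> + (L + C) * d powr (\<alpha> * (1 + \<gamma>))" by (simp add: algebra_simps)
    finally have *: "norm (germ z x r s + (x s - x r) + Q (z r) r s) \<le> K * d powr \<eta> + (L + C) * d powr (\<alpha> * (1 + \<gamma>))" .
    show ?thesis
      by (rule order_trans[OF norm_blinfun], rule mult_mono) (use DG * C in auto)
  qed
  have c: "norm (Q (z s) s t - Q (z r) s t) \<le> C * M * d powr \<eta>"
  proof -
    have "norm (Q (z s) s t - Q (z r) s t) \<le> C * norm (z s - z r) powr \<gamma> * (t - s) powr (2 * \<alpha>)"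
      by (rule Q_diff) (use rst in auto)
    also have "\<dots> \<le> C * (M * d powr \<alpha>) powr \<gamma> * d powr (2 * \<alpha>)"
      using C z \<gamma> \<alpha> rst d(4) by (intro mult_mono mult_left_mono powr_mono2) auto
    also have "\<dots> = C * (M powr \<gamma> * d powr \<eta>)" using M p(2) by (simp add: powr_mult powr_powr mult.assoc)
    also have "\<dots> \<le> C * (M * d powr \<eta>)" using Mp C by (intro mult_left_mono mult_right_mono) auto
    finally show ?thesis by simp
  qed
  have "norm (germ z x r t - germ z x r s - germ z x s t) \<le>
     norm ((G (z s) - G (z r) - DG (z r) (z s - z r)) (X t - X s))
    + norm (DG (z r) (germ z x r s + (x s - x r) + Q (z r) r s) (X t - X s)) + norm (Q (z s) s t - Q (z r) s t)"
    unfolding germ_defect[OF rst(1-4)] by (metis norm_triangle_mono order_refl)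
  also have "\<dots> \<le> (C * M^2 * d powr (\<alpha> * (1 + \<gamma>))) * (C * d powr \<alpha>)
    + (C * (K * d powr \<eta> + (L + C) * d powr (\<alpha> * (1 + \<gamma>)))) * (C * d powr \<alpha>) + C * M * d powr \<eta>"
  proof (intro add_mono c)
    show "norm ((G (z s) - G (z r) - DG (z r) (z s - z r)) (X t - X s)) \<le> (C * M^2 * d powr (\<alpha> * (1 + \<gamma>))) * (C * d powr \<alpha>)"
      by (rule order_trans[OF norm_blinfun], rule mult_mono[OF a Xst]) (use C in auto)
    show "norm (DG (z r) (germ z x r s + (x s - x r) + Q (z r) r s) (X t - X s))
        \<le> (C * (K * d powr \<eta> + (L + C) * d powr (\<alpha> * (1 + \<gamma>)))) * (C * d powr \<alpha>)"
      by (rule order_trans[OF norm_blinfun], rule mult_mono[OF b Xst]) (use C K x in auto)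
  qed
  also have "\<dots> = (C * (C * M^2 + C * L + C^2) + C * M) * d powr \<eta> + C^2 * d powr \<alpha> * K * d powr \<eta>"
    unfolding p(1)[symmetric] by (simp add: algebra_simps power2_eq_square)
  also have "\<dots> \<le> (C * (C * M^2 + C * L + C^2) + C * M) * d powr \<eta> + C^2 * S powr \<alpha> * K * d powr \<eta>"
    using C K d \<alpha> by (intro add_left_mono mult_right_mono mult_left_mono powr_mono2) auto
  finally show ?thesis unfolding defect_const_def M_def d_def by (simp add: algebra_simps)
qed

text \<open>The germ is known to vanish only from the left end \<open>r\<close> of the cell, so both
  end points are expanded from \<open>r\<close> and the expansions subtracted. Moving the second
  order term from \<open>r\<close> to \<open>s\<close> costs the Chen cross term, bounded with
  \<open>C^4\<close>.\<close>

lemma cell_increment_bound: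
  assumes r: "0 \<le> r" "r \<le> s" "s \<le> t" "t \<le> T" "t - r \<le> 1"
    and g: "germ z x r s = 0" "germ z x r t = 0"
    and x: "norm (x t - x s) \<le> L * (t - s)" "L \<ge> 0"
  shows "norm (z t - z s) \<le> incr_const L * (t - s) powr \<alpha>"
proof -
  define d where "d = t - s"
  have d: "0 \<le> d" "d \<le> 1" using r by (auto simp: d_def)
  have e: "z u - z r = (x u - x r) + G (z r) (X u - X r) + Q (z r) r u + germ z x r u" for u
    by (simp add: germ_def)
  have "z t - z s = (z t - z r) - (z s - z r)" by simp
  also have "\<dots> = ((x t - x r) + G (z r) (X t - X r) + Q (z r) r t) - ((x s - x r) + G (z r) (X s - X r) + Q (z r) r s)"
    unfolding e g by simp
  also have "\<dots> = (x t - x s) + G (z r) (X t - X s) + Q (z r) s t + DG (z r) (G (z r) (X s - X r)) (X t - X s)"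
    unfolding Q_chen[OF r(1-4)] by (simp add: blinfun.diff_right)
  finally have "norm (z t - z s) \<le> norm (x t - x s) + norm (G (z r) (X t - X s)) + norm (Q (z r) s t)
     + norm (DG (z r) (G (z r) (X s - X r)) (X t - X s))"
    by (metis norm_triangle_mono order_refl)
  also have "\<dots> \<le> L * d powr \<alpha> + C^2 * d powr \<alpha> + C * d powr \<alpha> + C^4 * d powr \<alpha>"
  proof (intro add_mono)
    show "norm (x t - x s) \<le> L * d powr \<alpha>"
      using x mult_left_mono[OF powr_le_\<alpha>(1)[OF d] x(2)] by (simp add: d_def)
    show "norm (G (z r) (X t - X s)) \<le> C^2 * d powr \<alpha>" unfolding d_def by (rule GX) (use r in auto)
    have "norm (Q (z r) s t) \<le> C * d powr (2 * \<alpha>)" unfolding d_def by (rule Q) (use r in auto)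
    also have "\<dots> \<le> C * d powr \<alpha>" using C powr_le_\<alpha>(2)[OF d] by (intro mult_left_mono) auto
    finally show "norm (Q (z r) s t) \<le> C * d powr \<alpha>" .
    have "norm (G (z r) (X s - X r)) \<le> C^2 * (s - r) powr \<alpha>" by (rule GX) (use r in auto)
    also have "\<dots> \<le> C^2 * 1" using r \<alpha> powr_mono2[of \<alpha> "s - r" 1] by (intro mult_left_mono) auto
    finally have 1: "norm (G (z r) (X s - X r)) \<le> C^2" by simp
    have 2: "norm (DG (z r) (G (z r) (X s - X r))) \<le> C * C^2"
      by (rule order_trans[OF norm_blinfun], rule mult_mono) (use 1 DG C in auto)
    have "norm (DG (z r) (G (z r) (X s - X r)) (X t - X s)) \<le> (C * C^2) * (C * d powr \<alpha>)"
      unfolding d_def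
      by (rule order_trans[OF norm_blinfun], rule mult_mono) (use 2 X[of s t] r C in auto)
    then show "norm (DG (z r) (G (z r) (X s - X r)) (X t - X s)) \<le> C^4 * d powr \<alpha>"
      by (simp add: power2_eq_square power4_eq_xxxx mult.assoc)
  qed
  also have "\<dots> = (L + C^2 + C + C^4) * d powr \<alpha>" by (simp add: algebra_simps)
  also have "\<dots> \<le> incr_const L * d powr \<alpha>" unfolding incr_const_def by (intro mult_right_mono) auto
  finally show ?thesis by (simp add: d_def)
qed

section \<open>From one grid step to the whole horizon\<close>

lemma grid_germ_bound:
  assumes h: "h \<ge> 0" "real N * h \<le> S" and S: "S \<le> T" "S \<le> 1"
    and x: "\<And>s t. 0 \<le> s \<Longrightarrow> s \<le> t \<Longrightarrow> t \<le> S \<Longrightarrow> norm (x t - x s) \<le> L * (t - s)" "L \<ge> 0"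
    and step: "\<And>k. k < N \<Longrightarrow> germ z x (real k * h) (real (Suc k) * h) = 0"
    and K: "K \<ge> 0" "K * S powr (\<eta> - \<alpha>) \<le> 1"
      "2 powr (1 - \<eta>) * K + 2 * (defect_const L + C^2 * S powr \<alpha> * K) \<le> K"
    and ik: "i \<le> k" "k \<le> N"
  shows "norm (germ z x (real i * h) (real k * h)) \<le> K * (real k * h - real i * h) powr \<eta>"
proof -
  \<comment> \<open>The cutoff makes \<open>J k k = 0\<close> hold for every \<open>k\<close>;
    beyond the horizon the locale gives no control of \<open>Q\<close> on the diagonal.\<close>
  define J where "J i k = (if k \<le> N then germ z x (real i * h) (real k * h) else 0)" for i k :: nat
  have le: "real m * h \<le> S" if "m \<le> N" for m
    using mult_right_mono[of "real m" "real N" h] that h by simp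
  have sub: "h * real (m - n) = real m * h - real n * h" if "n \<le> m" for m n
    using that by (simp add: algebra_simps)
  have M: "incr_const L \<ge> 1" by (rule incr_const_ge_1[OF x(2)])
  have "norm (J i k) \<le> K * (h * real (k - i)) powr \<eta>"
  proof (rule discrete_sewing[where D = "defect_const L + C^2 * S powr \<alpha> * K" and N = N])
    show "J k k = 0" for k
    proof (cases "k \<le> N")
      case True
      then show ?thesis using le[of k] h S unfolding J_def germ_def by (simp add: Q_refl)
    qed (simp add: J_def)
    show "J k (Suc k) = 0" if "k < N" for k using step[OF that] that by (simp add: J_def)
    show "defect_const L + C^2 * S powr \<alpha> * K \<ge> 0"
      using M C K x(2) unfolding defect_const_def by simp
    show "norm (J i k - J i l - J l k) \<le> (defect_const L + C^2 * S powr \<alpha> * K) * (h * real (k - i)) powr \<eta>"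
      if "i \<le> l" "l \<le> k" "k \<le> N" "norm (J i l) \<le> K * (h * real (l - i)) powr \<eta>" for i l k
    proof -
      have o: "0 \<le> real i * h" "real i * h \<le> real l * h" "real l * h \<le> real k * h" "real k * h \<le> S"
        using that h le[of k] by (auto intro: mult_right_mono)
      have J: "J i k = germ z x (real i * h) (real k * h)" "J i l = germ z x (real i * h) (real l * h)"
        "J l k = germ z x (real l * h) (real k * h)" using that by (auto simp: J_def)
      have "i \<le> k" using that by simp
      from sub[OF this] sub[OF that(1)] show ?thesis
        unfolding J using that(4)[unfolded J]
        by (intro order_trans[OF germ_defect_bound[where S = S and K = K and L = L]])
          (use o S K x in auto)
    qed
  qed (use h \<eta> K ik in auto)
  then show ?thesis using ik sub[OF ik(1)] by (simp add: J_def)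
qed

lemma grid_cell:
  fixes h s :: real
  assumes "N > 0" "0 \<le> s" "s \<le> real N * h"
  shows "\<exists>i<N. real i * h \<le> s \<and> s \<le> real (Suc i) * h"
  using assms
proof (induction N)
  case (Suc N)
  show ?case
  proof (cases "N > 0 \<and> s \<le> real N * h")
    case True
    then show ?thesis using Suc by (meson less_Suc_eq)
  next
    case False
    then show ?thesis using Suc.prems by (intro exI[of _ N]) auto
  qed
qed simp

text \<open>Two times in different cells are joined by a partial cell, a stretch between grid points
  and another partial cell, each costing \<open>incr_const L\<close>; hence the factor 3.\<close>

lemma holder_bound:
  assumes h: "h > 0" "real N * h = S" and S: "S \<le> T" "S \<le> 1" "N > 0"
    and x: "\<And>s t. 0 \<le> s \<Longrightarrow> s \<le> t \<Longrightarrow> t \<le> S \<Longrightarrow> norm (x t - x s) \<le> L * (t - s)" "L \<ge> 0"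
    and step: "\<And>k t. k < N \<Longrightarrow> real k * h \<le> t \<Longrightarrow> t \<le> real (Suc k) * h \<Longrightarrow> germ z x (real k * h) t = 0"
    and K: "K \<ge> 0" "K * S powr (\<eta> - \<alpha>) \<le> 1"
      "2 powr (1 - \<eta>) * K + 2 * (defect_const L + C^2 * S powr \<alpha> * K) \<le> K"
    and st: "0 \<le> s" "s \<le> t" "t \<le> S"
  shows "norm (z t - z s) \<le> 3 * incr_const L * (t - s) powr \<alpha>"
proof -
  define M where "M = incr_const L"
  have M: "M \<ge> 1" unfolding M_def by (rule incr_const_ge_1[OF x(2)])
  have le: "real m * h \<le> S" if "m \<le> N" for m
    using mult_right_mono[of "real m" "real N" h] that h by simp
  have cell: "norm (z t - z s) \<le> M * (t - s) powr \<alpha>"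
    if "k < N" "real k * h \<le> s" "s \<le> t" "t \<le> real (Suc k) * h" for k s t
  proof -
    have "t \<le> S" using le[of "Suc k"] that by simp
    moreover have "0 \<le> real k * h" using h by simp
    ultimately show ?thesis unfolding M_def
      by (intro cell_increment_bound[where r = "real k * h" and x = x]) (use that S x step[OF that(1)] in auto)
  qed
  have grid: "norm (z (real k * h) - z (real i * h)) \<le> M * (real k * h - real i * h) powr \<alpha>"
    if "i \<le> k" "k \<le> N" for i k
  proof -
    have o: "0 \<le> real i * h" "real i * h \<le> real k * h" "real k * h \<le> S"
      using that h le[of k] by (auto intro: mult_right_mono)
    have "norm (germ z x (real i * h) (real k * h)) \<le> K * (real k * h - real i * h) powr \<eta>"
      by (rule grid_germ_bound[where N = N and S = S and L = L]) (use h S x step K that in auto)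
    moreover have "K * (real k * h - real i * h) powr (\<eta> - \<alpha>) \<le> K * S powr (\<eta> - \<alpha>)"
      using K o \<eta> by (intro mult_left_mono powr_mono2) auto
    ultimately show ?thesis unfolding M_def
      by (intro increment_bound[where x = x and K = K]) (use o S x K in auto)
  qed
  have mono: "M * (b - a) powr \<alpha> \<le> M * (t - s) powr \<alpha>" if "s \<le> a" "a \<le> b" "b \<le> t" for a b
    using M \<alpha> that by (intro mult_left_mono powr_mono2) auto
  obtain i where i: "i < N" "real i * h \<le> s" "s \<le> real (Suc i) * h" using grid_cell[of N s h] S st h by auto
  obtain k where k: "k < N" "real k * h \<le> t" "t \<le> real (Suc k) * h" using grid_cell[of N t h] S st h by auto
  have "norm (z t - z s) \<le> 3 * (M * (t - s) powr \<alpha>)"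
  proof (cases "t \<le> real (Suc i) * h")
    case True
    have "norm (z t - z s) \<le> M * (t - s) powr \<alpha>" using cell[OF i(1,2) st(2) True] .
    moreover have "0 \<le> M * (t - s) powr \<alpha>" using M by simp
    ultimately show ?thesis by linarith
  next
    case False
    then have "real (Suc i) * h < real (Suc k) * h" using k by linarith
    then have ik: "Suc i \<le> k" using h by simp
    then have o: "real (Suc i) * h \<le> real k * h" using h by (intro mult_right_mono) auto
    have "norm (z t - z s) \<le> norm (z t - z (real k * h)) + norm (z (real k * h) - z (real (Suc i) * h))
        + norm (z (real (Suc i) * h) - z s)"
      using norm_triangle_ineq[of "z t - z (real k * h)" "z (real k * h) - z (real (Suc i) * h)"]
        norm_triangle_ineq[of "z t - z (real (Suc i) * h)" "z (real (Suc i) * h) - z s"] by simp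
    also have "\<dots> \<le> M * (t - s) powr \<alpha> + M * (t - s) powr \<alpha> + M * (t - s) powr \<alpha>"
    proof (intro add_mono)
      show "norm (z t - z (real k * h)) \<le> M * (t - s) powr \<alpha>"
        by (rule order_trans[OF cell mono]) (use k i o in auto)
      show "norm (z (real k * h) - z (real (Suc i) * h)) \<le> M * (t - s) powr \<alpha>"
        by (rule order_trans[OF grid mono]) (use k i o ik in auto)
      show "norm (z (real (Suc i) * h) - z s) \<le> M * (t - s) powr \<alpha>"
        by (rule order_trans[OF cell mono]) (use k i o in auto)
    qed
    finally show ?thesis by simp
  qed
  then show ?thesis by (simp add: M_def)
qed

text \<open>On each grid cell the drift is evaluated along the path stopped at the left end point, so that
  the scheme is explicit although \<open>V\<close> takes whole paths as arguments.\<close>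

lemma euler_scheme:
  assumes h: "h > 0" "real N * h \<le> T"
    and V: "\<And>w a b. 0 \<le> a \<Longrightarrow> b \<le> real N * h \<Longrightarrow> V w integrable_on {a..b}"
  obtains z v where "z 0 = \<xi>" "v integrable_on {0..real N * h}"
    "\<And>s. v s = V (\<lambda>r. z (min r (real_of_int \<lfloor>s / h\<rfloor> * h))) s"
    "\<And>k t. k < N \<Longrightarrow> real k * h \<le> t \<Longrightarrow> t \<le> real (Suc k) * h \<Longrightarrow>
      germ z (\<lambda>t. integral {0..t} v) (real k * h) t = 0"
proof -
  \<comment> \<open>The path \<open>P k\<close> is built up to time \<open>k * h\<close> and frozen
    afterwards, so it is itself the stopped path that \<open>V\<close> receives on cell
    \<open>k\<close>.\<close>
  define step where "step k w t = (if t \<le> real k * h then w t else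
      (let t' = min t (real (Suc k) * h); y = w (real k * h) in
       y + integral {real k * h..t'} (V w) + G y (X t' - X (real k * h)) + Q y (real k * h) t'))"
    for k and w :: "real \<Rightarrow> 'b" and t :: real
  define P where "P = rec_nat (\<lambda>_. \<xi>) step"
  have P0: "P 0 = (\<lambda>_. \<xi>)" and PS: "P (Suc k) = step k (P k)" for k by (simp_all add: P_def)
  have P_stop: "P k t = P k (real k * h)" if "t \<ge> real k * h" for k t
    using that h by (cases k) (auto simp: P0 PS step_def min_def Let_def field_simps)
  have P_min: "P k (min t (real j * h)) = P j t" if "j \<le> k" for j k t
    using that
  proof (induction k rule: dec_induct)
    case base
    show ?case using P_stop[of j t] by (simp add: min_def)
  next
    case (step k)
    have "real j * h \<le> real k * h" using step h by (intro mult_right_mono) auto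
    then have "min t (real j * h) \<le> real k * h" by simp
    then show ?case using step by (simp add: PS step_def)
  qed
  define z where "z = P N"
  define v where "v s = V (\<lambda>r. z (min r (real_of_int \<lfloor>s / h\<rfloor> * h))) s" for s
  have v_eq: "v s = V (P k) s" if "k \<le> N" "real k * h \<le> s" "s < real (Suc k) * h" for k s
  proof -
    have "\<lfloor>s / h\<rfloor> = int k" using that h by (intro floor_unique) (auto simp: field_simps)
    then have "(\<lambda>r. z (min r (real_of_int \<lfloor>s / h\<rfloor> * h))) = P k"
      unfolding z_def using P_min[OF that(1)] by (simp add: fun_eq_iff)
    then show ?thesis by (simp add: v_def)
  qed
  have le: "real m * h \<le> real N * h" if "m \<le> N" for m
    using that h by (intro mult_right_mono) auto
  \<comment> \<open>At the right end of a cell the floor already points to the next cell, so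
    \<open>v\<close> and \<open>V (P k)\<close> agree only up to that single time.\<close>
  have neg: "negligible {real (Suc k) * h}" for k by simp
  have v_int: "v integrable_on {real k * h..t}" "integral {real k * h..t} v = integral {real k * h..t} (V (P k))"
    if "k < N" "t \<le> real (Suc k) * h" for k t
  proof -
    have tN: "t \<le> real N * h" using that le[of "Suc k"] by simp
    have "0 \<le> real k * h" using h by simp
    then have I: "V (P k) integrable_on {real k * h..t}" using V tN by blast
    have eq: "v s = V (P k) s" if "s \<in> {real k * h..t} - {real (Suc k) * h}" for s
      using v_eq[of k s] that \<open>k < N\<close> \<open>t \<le> real (Suc k) * h\<close> by auto
    show "v integrable_on {real k * h..t}" by (rule integrable_spike[OF I neg eq])
    show "integral {real k * h..t} v = integral {real k * h..t} (V (P k))"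
      by (rule integral_spike[OF neg eq, symmetric])
  qed
  have vI: "v integrable_on {0..real k * h}" if "k \<le> N" for k
    using that
  proof (induction k)
    case (Suc k)
    show ?case
      by (rule Henstock_Kurzweil_Integration.integrable_combine[where c = "real k * h"]) (use Suc v_int(1)[of k] h in \<open>auto intro: mult_right_mono\<close>)
  next
    case 0
    show ?case using integrable_on_refl[of v 0] by simp
  qed
  show thesis
  proof (rule that)
    show "z 0 = \<xi>" using P_min[of 0 N 0] by (simp add: z_def P0)
    show "v integrable_on {0..real N * h}" by (rule vI) simp
    show "v s = V (\<lambda>r. z (min r (real_of_int \<lfloor>s / h\<rfloor> * h))) s" for s by (rule v_def)
    fix k t assume k: "k < N" and t: "real k * h \<le> t" "t \<le> real (Suc k) * h"
    have "v integrable_on {0..t}"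
      by (rule Henstock_Kurzweil_Integration.integrable_combine[where c = "real k * h"]) (use vI[of k] v_int(1)[OF k t(2)] k t h in auto)
    from Henstock_Kurzweil_Integration.integral_combine[OF _ t(1) this]
    have x: "integral {0..t} v - integral {0..real k * h} v = integral {real k * h..t} v" using h by (simp add: algebra_simps)
    have zk: "z (real k * h) = P k (real k * h)" using P_min[of k N "real k * h"] k by (simp add: z_def)
    have zt: "z t = P (Suc k) t" using P_min[of "Suc k" N t] k t by (simp add: z_def)
    show "germ z (\<lambda>t. integral {0..t} v) (real k * h) t = 0"
    proof (cases "t = real k * h")
      case True
      then have "0 \<le> t" using h by simp
      moreover have "t \<le> T" using le[of "Suc k"] k t(2) h(2) by linarith
      ultimately have "Q (z t) t t = 0" by (rule Q_refl)
      then show ?thesis using True by (simp add: germ_def)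
    next
      case False
      then have "P (Suc k) t = P k (real k * h) + integral {real k * h..t} (V (P k))
        + G (P k (real k * h)) (X t - X (real k * h)) + Q (P k (real k * h)) (real k * h) t"
        using t by (simp add: PS step_def Let_def min_absorb1)
      then show ?thesis unfolding germ_def x zt zk v_int(2)[OF k t(2)] by simp
    qed
  qed
qed

end


section \<open>Passage to the limit\<close>

lemma powr_modulus:
  assumes "\<beta> > 0" "(e::real) > 0"
  shows "\<exists>d>0. \<forall>r. 0 \<le> r \<longrightarrow> r < d \<longrightarrow> c * r powr \<beta> < e"
proof (intro exI conjI allI impI)
  define d where "d = (e / (\<bar>c\<bar> + 1)) powr (1 / \<beta>)"
  show "d > 0" using assms by (simp add: d_def)
  fix r :: real assume r: "0 \<le> r" "r < d"
  have "c * r powr \<beta> \<le> \<bar>c\<bar> * r powr \<beta>" by (intro mult_right_mono) auto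
  also have "\<dots> \<le> \<bar>c\<bar> * d powr \<beta>" using r assms by (intro mult_left_mono powr_mono2) auto
  also have "\<dots> = \<bar>c\<bar> * (e / (\<bar>c\<bar> + 1))" using assms by (simp add: d_def powr_powr)
  also have "\<dots> < e" using assms by (simp add: field_simps)
  finally show "c * r powr \<beta> < e" .
qed

lemma holder_imp_continuous_on:
  fixes f :: "real \<Rightarrow> 'b::real_normed_vector"
  assumes "\<And>s t. s \<in> A \<Longrightarrow> t \<in> A \<Longrightarrow> s \<le> t \<Longrightarrow> norm (f t - f s) \<le> c * (t - s) powr \<beta>" "\<beta> > 0"
  shows "continuous_on A f"
proof (rule continuous_onI)
  fix x e :: real assume x: "x \<in> A" and e: "e > 0"
  obtain d where d: "d > 0" "\<And>r. 0 \<le> r \<Longrightarrow> r < d \<Longrightarrow> c * r powr \<beta> < e" using powr_modulus[OF assms(2) e] by blast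
  have "dist (f y) (f x) \<le> e" if "y \<in> A" "dist y x < d" for y
  proof (cases "x \<le> y")
    case True
    then show ?thesis using assms(1)[OF x that(1)] d(2)[of "y - x"] that by (simp add: dist_norm)
  next
    case False
    then show ?thesis using assms(1)[OF that(1) x] d(2)[of "x - y"] that by (simp add: dist_norm norm_minus_commute)
  qed
  then show "\<exists>d>0. \<forall>x'\<in>A. dist x' x < d \<longrightarrow> dist (f x') (f x) \<le> e" using d(1) by blast
qed

lemma integrable_on_bounded_continuous_countable_exceptions:
  fixes f :: "real \<Rightarrow> 'b::euclidean_space"
  assumes N: "countable N" and f: "\<And>t. t \<in> {0..S} - N \<Longrightarrow> continuous (at t within {0..S}) f"
    and b: "\<And>t. t \<in> {0..S} \<Longrightarrow> norm (f t) \<le> L"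
  shows "f integrable_on {0..S}"
proof -
  \<comment> \<open>Extension by zero gives a function on the whole line at the price of two further
    exceptional points, \<open>0\<close> and \<open>S\<close>; measurability then follows from
    countability of the exceptions.\<close>
  define g where "g t = (if t \<in> {0..S} then f t else 0)" for t
  have "continuous_on (- (N \<union> {0, S})) g"
  proof (rule continuous_at_imp_continuous_on, rule ballI)
    fix t assume t: "t \<in> - (N \<union> {0, S})"
    consider "t \<in> {0<..<S}" | "t \<in> - {0..S}" using t by force
    then show "isCont g t"
    proof cases
      case 1
      then have "continuous (at t within {0..S}) f" using f t by auto
      then have "isCont f t" using 1 by (simp add: at_within_Icc_at)
      moreover have "\<forall>\<^sub>F s in nhds t. s \<in> {0<..<S}" using 1 by (intro eventually_nhds_in_open) auto
      then have "\<forall>\<^sub>F s in nhds t. g s = f s" by (rule eventually_mono) (auto simp: g_def)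
      ultimately show ?thesis by (simp add: isCont_cong)
    next
      case 2
      have "\<forall>\<^sub>F s in nhds t. s \<in> - {0..S}" using 2 by (intro eventually_nhds_in_open) auto
      then have "\<forall>\<^sub>F s in nhds t. g s = 0" by (rule eventually_mono) (auto simp: g_def)
      then show ?thesis by (simp add: isCont_cong)
    qed
  qed
  then have "g \<in> borel_measurable borel"
    using N by (intro borel_measurable_continuous_countable_exceptions[of "N \<union> {0, S}"]) auto
  then have "g \<in> borel_measurable lebesgue" by (simp add: measurable_completion)
  then have m: "g \<in> borel_measurable (lebesgue_on {0..S})" by (rule measurable_restrict_space1)
  have "g integrable_on {0..S}"
    by (rule measurable_bounded_by_integrable_imp_integrable[OF m, of "\<lambda>_. L"])
      (use b in \<open>auto simp: g_def integrable_const_ivl\<close>)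
  then show ?thesis by (rule integrable_eq) (simp add: g_def)
qed

lemma integral_increment_bound:
  fixes f :: "real \<Rightarrow> 'b::banach"
  assumes f: "f integrable_on {0..S}" and b: "\<And>t. t \<in> {0..S} \<Longrightarrow> norm (f t) \<le> L" and L: "L \<ge> 0"
    and st: "0 \<le> s" "s \<le> t" "t \<le> S"
  shows "norm (integral {0..t} f - integral {0..s} f) \<le> L * (t - s)"
proof -
  have "f integrable_on {0..t}" using integrable_on_subinterval[OF f] st by auto
  from Henstock_Kurzweil_Integration.integral_combine[OF st(1,2) this]
  have "integral {0..t} f - integral {0..s} f = integral {s..t} f" by (simp add: algebra_simps)
  moreover have "f integrable_on {s..t}" using integrable_on_subinterval[OF f] st by auto
  then have "norm (integral {s..t} f) \<le> L * (t - s)"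
    using has_integral_bound[OF L, of f "integral {s..t} f" s t] b st by (auto simp: integrable_integral)
  ultimately show ?thesis by simp
qed

context rough_coefficients
begin

text \<open>The common starting point and Hoelder constant provide equicontinuity and, for a short
  horizon, confinement to the ball around \<xi>.\<close>

definition path_class :: "real \<Rightarrow> real \<Rightarrow> 'b \<Rightarrow> (real \<Rightarrow> 'b) set" where
  "path_class M S \<xi> = {z. z 0 = \<xi> \<and> (\<forall>s t. 0 \<le> s \<longrightarrow> s \<le> t \<longrightarrow> t \<le> S \<longrightarrow> norm (z t - z s) \<le> M * (t - s) powr \<alpha>)}"

text \<open>Ensures that the stopped paths fed to the selection by the Euler scheme stay in its
  domain.\<close>

lemma path_class_stopped:
  assumes z: "z \<in> path_class M S \<xi>" and a: "0 \<le> a" and M: "M \<ge> 0"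
  shows "(\<lambda>r. z (min r a)) \<in> path_class M S \<xi>"
proof -
  have "norm (z (min t a) - z (min s a)) \<le> M * (t - s) powr \<alpha>" if "0 \<le> s" "s \<le> t" "t \<le> S" for s t
  proof -
    have "norm (z (min t a) - z (min s a)) \<le> M * (min t a - min s a) powr \<alpha>"
      using z that a unfolding path_class_def by auto
    also have "\<dots> \<le> M * (t - s) powr \<alpha>" using M \<alpha> that by (intro mult_left_mono powr_mono2) auto
    finally show ?thesis .
  qed
  then show ?thesis using z a unfolding path_class_def by simp
qed

lemma X_cont: "continuous_on {0..T} X"
  by (rule holder_imp_continuous_on[OF X]) (use \<alpha> in auto)

lemma Q_cont: "continuous_on {0..T} (Q a 0)"
proof (rule holder_imp_continuous_on)
  fix s t assume st: "s \<in> {0..T}" "t \<in> {0..T}" "s \<le> t"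
  have p: "(t - s) powr \<alpha> \<le> T powr \<alpha>" "s powr \<alpha> \<le> T powr \<alpha>" using st \<alpha> by (intro powr_mono2; simp)+
  have "Q a 0 t - Q a 0 s = Q a s t + DG a (G a (X s - X 0)) (X t - X s)"
    using Q_chen[of 0 s t a] st by simp
  then have "norm (Q a 0 t - Q a 0 s) \<le> norm (Q a s t) + norm (DG a (G a (X s - X 0)) (X t - X s))"
    by (metis norm_triangle_ineq)
  also have "\<dots> \<le> C * T powr \<alpha> * (t - s) powr \<alpha> + C * (C^2 * T powr \<alpha>) * (C * (t - s) powr \<alpha>)"
  proof (rule add_mono)
    have "norm (Q a s t) \<le> C * (t - s) powr (2 * \<alpha>)" using Q st by auto
    also have "\<dots> = C * (t - s) powr \<alpha> * (t - s) powr \<alpha>" by (simp flip: powr_add)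
    also have "\<dots> \<le> C * T powr \<alpha> * (t - s) powr \<alpha>" using p C by (intro mult_right_mono mult_left_mono) auto
    finally show "norm (Q a s t) \<le> C * T powr \<alpha> * (t - s) powr \<alpha>" .
    have GX': "norm (G a (X s - X 0)) \<le> C^2 * T powr \<alpha>"
      using GX[of 0 s a] st p mult_left_mono[OF p(2), of "C^2"] by auto
    have 1: "norm (DG a (G a (X s - X 0))) \<le> C * (C^2 * T powr \<alpha>)"
      by (rule order_trans[OF norm_blinfun], intro mult_mono) (use GX' C DG in auto)
    show "norm (DG a (G a (X s - X 0)) (X t - X s)) \<le> C * (C^2 * T powr \<alpha>) * (C * (t - s) powr \<alpha>)"
      by (rule order_trans[OF norm_blinfun], rule mult_mono[OF 1]) (use X st C in auto)
  qed
  also have "\<dots> = (C * T powr \<alpha> + C * (C^2 * T powr \<alpha>) * C) * (t - s) powr \<alpha>" by (simp add: algebra_simps)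
  finally show "norm (Q a 0 t - Q a 0 s) \<le> \<dots>" .
qed (use \<alpha> in auto)

lemma G_tendsto:
  assumes "(f \<longlongrightarrow> a) Fl" shows "((\<lambda>x. G (f x)) \<longlongrightarrow> G a) Fl"
proof (rule Lim_null_comparison[THEN Lim_null[THEN iffD2]])
  show "\<forall>\<^sub>F x in Fl. norm (G (f x) - G a) \<le> C * norm (f x - a)" using G_lip by simp
  show "((\<lambda>x. C * norm (f x - a)) \<longlongrightarrow> 0) Fl"
    by (intro tendsto_mult_right_zero tendsto_norm_zero LIM_zero assms)
qed

text \<open>Joint continuity in both times comes from Chen's relation, which expresses
  \<open>Q a s t\<close> through the one-parameter function \<open>Q a 0\<close> and increments of
  \<open>X\<close>; the moving base point is then handled by \<open>Q_diff\<close>.\<close>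

lemma Q_tendsto:
  assumes a: "an \<longlonglongrightarrow> a" and s: "sn \<longlonglongrightarrow> s" and t: "tn \<longlonglongrightarrow> t"
    and le: "\<And>n::nat. 0 \<le> sn n" "\<And>n. sn n \<le> tn n" "\<And>n. tn n \<le> T" "0 \<le> s" "s \<le> t" "t \<le> T"
  shows "(\<lambda>n. Q (an n) (sn n) (tn n)) \<longlonglongrightarrow> Q a s t"
proof -
  have sT: "sn n \<in> {0..T}" "tn n \<in> {0..T}" for n using le(1-3)[of n] by auto
  have sT': "s \<in> {0..T}" "t \<in> {0..T}" using le(4-6) by auto
  have Qe: "Q a s t = Q a 0 t - Q a 0 s - DG a (G a (X s - X 0)) (X t - X s)" if "0 \<le> s" "s \<le> t" "t \<le> T" for s t
    using Q_chen[of 0 s t a] that by simp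
  have c: "(\<lambda>n. f (sn n)) \<longlonglongrightarrow> f s" "(\<lambda>n. f (tn n)) \<longlonglongrightarrow> f t"
    if "continuous_on {0..T} f" for f :: "real \<Rightarrow> 'c::topological_space"
    by (rule continuous_on_tendsto_compose[OF that]; use sT sT' s t in simp)+
  have 1: "(\<lambda>n. Q a (sn n) (tn n)) \<longlonglongrightarrow> Q a s t"
    unfolding Qe[OF le(1-3)] Qe[OF le(4-6)] by (intro tendsto_intros c X_cont Q_cont)
  have 2: "(\<lambda>n. Q (an n) (sn n) (tn n) - Q a (sn n) (tn n)) \<longlonglongrightarrow> 0"
  proof (rule Lim_null_comparison)
    show "\<forall>\<^sub>F n in sequentially. norm (Q (an n) (sn n) (tn n) - Q a (sn n) (tn n)) \<le> C * norm (an n - a) powr \<gamma> * T powr (2 * \<alpha>)"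
    proof (intro always_eventually allI)
      fix n
      have "norm (Q (an n) (sn n) (tn n) - Q a (sn n) (tn n)) \<le> C * norm (an n - a) powr \<gamma> * (tn n - sn n) powr (2 * \<alpha>)"
        by (rule Q_diff[OF le(1-3)])
      also have "\<dots> \<le> C * norm (an n - a) powr \<gamma> * T powr (2 * \<alpha>)"
        using C \<alpha> le(1-3)[of n] by (intro mult_left_mono powr_mono2) auto
      finally show "norm (Q (an n) (sn n) (tn n) - Q a (sn n) (tn n)) \<le> \<dots>" .
    qed
    have "(\<lambda>n. norm (an n - a)) \<longlonglongrightarrow> 0" by (rule tendsto_norm_zero[OF LIM_zero[OF a]])
    then have "(\<lambda>n. norm (an n - a) powr \<gamma>) \<longlonglongrightarrow> 0 powr \<gamma>"
      using \<gamma> by (intro tendsto_powr') auto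
    then show "(\<lambda>n. C * norm (an n - a) powr \<gamma> * T powr (2 * \<alpha>)) \<longlonglongrightarrow> 0"
      by (intro tendsto_mult_left_zero tendsto_mult_right_zero) simp
  qed
  from tendsto_add[OF 1 2] show ?thesis by simp
qed

theorem exists_rough_solution:
  fixes u :: "(real \<Rightarrow> 'b) \<Rightarrow> real \<Rightarrow> 'b"
  assumes S: "0 < S" "S \<le> T" "S \<le> 1" and L: "L \<ge> 0"
    and K: "K \<ge> 0" "K * S powr (\<eta> - \<alpha>) \<le> 1"
      "2 powr (1 - \<eta>) * K + 2 * (defect_const L + C^2 * S powr \<alpha> * K) \<le> K"
    and Z_def: "Z = path_class (3 * incr_const L) S \<xi>"
    and u: "\<And>z t. z \<in> Z \<Longrightarrow> t \<in> {0..S} \<Longrightarrow> norm (u z t) \<le> L"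
    and stable: "\<And>z. z \<in> Z \<Longrightarrow> \<exists>N. countable N \<and> (\<forall>t\<in>{0..S} - N. stable_at Z S u z t)"
  shows "\<exists>z\<in>Z. \<forall>s t. 0 \<le> s \<longrightarrow> s \<le> t \<longrightarrow> t \<le> S \<longrightarrow>
    norm (germ z (\<lambda>t. integral {0..t} (u z)) s t) \<le> K * (t - s) powr \<eta>"
proof -
  define M where "M = 3 * incr_const L"
  have M: "M \<ge> 0" using incr_const_ge_1[OF L] by (simp add: M_def)
  have u_int: "u z integrable_on {0..S}" if "z \<in> Z" for z
    using stable[OF that] u[OF that]
    by (auto intro!: integrable_on_bounded_continuous_countable_exceptions[where L = L] simp: stable_at_def)
  \<comment> \<open>The zero default lets the scheme run before its paths are known to lie in
    \<open>Z\<close>. Bound and integrability hold for every argument, they imply membership in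
    \<open>Z\<close>, and so the default is never reached in the end.\<close>
  define V where "V w = (if w \<in> Z then u w else (\<lambda>_. 0))" for w
  have V_int: "V w integrable_on {0..S}" for w using u_int[of w] by (cases "w \<in> Z") (simp_all add: V_def integrable_0)
  have V_bd: "norm (V w t) \<le> L" if "t \<in> {0..S}" for w t using u that L by (simp add: V_def)
  define h where "h n = S / real (Suc n)" for n
  have h: "h n > 0" "real (Suc n) * h n = S" for n using S by (auto simp: h_def)
  have h0: "h \<longlonglongrightarrow> 0" unfolding h_def
    using LIMSEQ_Suc[OF lim_const_over_n[of S]] by simp
  define \<tau> where "\<tau> n t = real_of_int \<lfloor>t / h n\<rfloor> * h n" for n t
  have \<tau>: "0 \<le> \<tau> n t" "\<tau> n t \<le> t" "t - \<tau> n t < h n" if "t \<ge> 0" for n t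
    using floor_grid[OF h(1) that] by (auto simp: \<tau>_def)
  have \<tau>_lim: "(\<lambda>n. \<tau> n t) \<longlonglongrightarrow> t" if "t \<ge> 0" for t
  proof (rule metric_tendsto_imp_tendsto[OF h0])
    have "dist (\<tau> n t) t \<le> dist (h n) 0" for n using \<tau>[OF that, of n] h(1)[of n] by (simp add: dist_real_def)
    then show "\<forall>\<^sub>F n in sequentially. dist (\<tau> n t) t \<le> dist (h n) 0" by simp
  qed
  have "\<exists>z v. z 0 = \<xi> \<and> v integrable_on {0..S} \<and> (\<forall>s. v s = V (\<lambda>r. z (min r (\<tau> n s))) s) \<and>
    (\<forall>k<Suc n. \<forall>t. real k * h n \<le> t \<longrightarrow> t \<le> real (Suc k) * h n \<longrightarrow> germ z (\<lambda>t. integral {0..t} v) (real k * h n) t = 0)" for n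
  proof -
    have V_int': "V w integrable_on {a..b}" if "0 \<le> a" "b \<le> real (Suc n) * h n" for w a b
      by (rule integrable_on_subinterval[OF V_int]) (use that h(2)[of n] in auto)
    have hT: "real (Suc n) * h n \<le> T" using h(2) S by simp
    obtain z v where "z 0 = \<xi>" "v integrable_on {0..real (Suc n) * h n}"
      "\<And>s. v s = V (\<lambda>r. z (min r (real_of_int \<lfloor>s / h n\<rfloor> * h n))) s"
      "\<And>k t. k < Suc n \<Longrightarrow> real k * h n \<le> t \<Longrightarrow> t \<le> real (Suc k) * h n \<Longrightarrow>
      germ z (\<lambda>t. integral {0..t} v) (real k * h n) t = 0"
      using euler_scheme[where V = V and \<xi> = \<xi>, OF h(1) hT V_int'] by blast
    then show ?thesis unfolding h(2) \<tau>_def by blast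
  qed
  then obtain z v where z0: "\<And>n. z n 0 = \<xi>" and v_int: "\<And>n. v n integrable_on {0..S}"
    and v: "\<And>n s. v n s = V (\<lambda>r. z n (min r (\<tau> n s))) s"
    and step: "\<And>n k t. k < Suc n \<Longrightarrow> real k * h n \<le> t \<Longrightarrow> t \<le> real (Suc k) * h n \<Longrightarrow>
      germ (z n) (\<lambda>t. integral {0..t} (v n)) (real k * h n) t = 0"
    by metis
  define x where "x n t = integral {0..t} (v n)" for n t
  have v_bd: "norm (v n t) \<le> L" if "t \<in> {0..S}" for n t unfolding v by (rule V_bd[OF that])
  have x_lip: "norm (x n t - x n s) \<le> L * (t - s)" if "0 \<le> s" "s \<le> t" "t \<le> S" for n s t
    unfolding x_def by (rule integral_increment_bound[OF v_int v_bd L that])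
  have z_hold: "norm (z n t - z n s) \<le> M * (t - s) powr \<alpha>" if "0 \<le> s" "s \<le> t" "t \<le> S" for n s t
    unfolding M_def
    by (rule holder_bound[OF h S(2,3) _ x_lip L _ K that]) (use step in \<open>auto simp: x_def[abs_def]\<close>)
  \<comment> \<open>At this level the error estimate is known between grid points only; arbitrary
    times are reached in the limit, where \<open>\<tau> n t\<close> tends to
    \<open>t\<close>.\<close>
  have grid: "norm (germ (z n) (x n) (\<tau> n s) (\<tau> n t)) \<le> K * (\<tau> n t - \<tau> n s) powr \<eta>"
    if "0 \<le> s" "s \<le> t" "t \<le> S" for n s t
  proof -
    have nat: "\<tau> n t = real (nat \<lfloor>t / h n\<rfloor>) * h n" if "t \<ge> 0" for t
      using that h(1)[of n] by (simp add: \<tau>_def)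
    have "t / h n \<le> real (Suc n)" using that h[of n] by (simp add: divide_le_eq)
    then have "nat \<lfloor>t / h n\<rfloor> \<le> Suc n" by linarith
    moreover have "nat \<lfloor>s / h n\<rfloor> \<le> nat \<lfloor>t / h n\<rfloor>"
      using that h(1)[of n] by (intro nat_mono floor_mono divide_right_mono) auto
    moreover have "0 \<le> t" using that by simp
    ultimately show ?thesis unfolding nat[OF that(1)] nat[OF \<open>0 \<le> t\<close>]
      by (intro grid_germ_bound[where N = "Suc n" and S = S and L = L])
        (use h[of n] S x_lip L step[of _ n] K in \<open>auto simp: x_def[abs_def] less_imp_le\<close>)
  qed
  have zZ: "z n \<in> Z" for n using z_hold z0 unfolding Z_def path_class_def M_def by simp
  have ZM: "Z = path_class M S \<xi>" by (simp add: Z_def M_def)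
  have z_hold': "norm (z n t - z n s) \<le> M * \<bar>t - s\<bar> powr \<alpha>" if "s \<in> {0..S}" "t \<in> {0..S}" for n s t
    using z_hold[of s t n] z_hold[of t s n] that by (cases "s \<le> t") (auto simp: norm_minus_commute)
  have bdd: "norm (z n t) \<le> norm \<xi> + M * S powr \<alpha>" if "t \<in> {0..S}" for n t
  proof -
    have "norm (z n t - \<xi>) \<le> M * (t - 0) powr \<alpha>" using z_hold[of 0 t n] z0 that by simp
    also have "\<dots> \<le> M * S powr \<alpha>" using M \<alpha> that by (intro mult_left_mono powr_mono2) auto
    finally show ?thesis using norm_triangle_sub[of "z n t" \<xi>] by linarith
  qed
  obtain g k where g: "strict_mono (k :: nat \<Rightarrow> nat)"
    "\<And>e. 0 < e \<Longrightarrow> \<exists>N. \<forall>n x. n \<ge> N \<and> x \<in> {0..S} \<longrightarrow> norm (z (k n) x - g x) < e"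
  proof (rule Arzela_Ascoli[of "{0..S}" z "norm \<xi> + M * S powr \<alpha>"])
    fix t e :: real assume t: "t \<in> {0..S}" and e: "0 < e"
    obtain d where d: "d > 0" "\<And>r. 0 \<le> r \<Longrightarrow> r < d \<Longrightarrow> M * r powr \<alpha> < e"
      using powr_modulus[OF _ e, of \<alpha> M] \<alpha> by auto
    show "\<exists>d>0. \<forall>n y. y \<in> {0..S} \<and> norm (t - y) < d \<longrightarrow> norm (z n t - z n y) < e"
    proof (intro exI conjI allI impI)
      fix n y assume y: "y \<in> {0..S} \<and> norm (t - y) < d"
      then have "M * \<bar>t - y\<bar> powr \<alpha> < e" by (intro d(2)) auto
      then show "norm (z n t - z n y) < e" using z_hold'[of y t n] y t by simp
    qed (use d in simp)
  qed (use bdd in auto)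
  have k_lim: "filterlim k sequentially sequentially" using g(1) by (rule filterlim_subseq)
  \<comment> \<open>Evaluation at moving times combines uniform convergence with the common Hoelder
    bound.\<close>
  have unif: "(\<lambda>n. z (k n) (r n)) \<longlonglongrightarrow> g t" if r: "\<And>n. r n \<in> {0..S}" "r \<longlonglongrightarrow> t" "t \<in> {0..S}" for r t
  proof (rule tendstoI)
    fix e :: real assume e: "e > 0"
    obtain N where N: "\<And>n x. n \<ge> N \<Longrightarrow> x \<in> {0..S} \<Longrightarrow> norm (z (k n) x - g x) < e / 2"
      using g(2)[of "e / 2"] e by auto
    obtain d where d: "d > 0" "\<And>r. 0 \<le> r \<Longrightarrow> r < d \<Longrightarrow> M * r powr \<alpha> < e / 2"
      using powr_modulus[of \<alpha> "e / 2" M] \<alpha> e by auto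
    have "\<forall>\<^sub>F n in sequentially. dist (r n) t < d" using r(2) d(1) by (rule tendstoD)
    then show "\<forall>\<^sub>F n in sequentially. dist (z (k n) (r n)) (g t) < e"
      using eventually_ge_at_top[of N]
    proof eventually_elim
      case (elim n)
      then have "norm (z (k n) (r n) - z (k n) t) < e / 2"
        using z_hold'[OF r(3) r(1), of "k n" n] d(2)[of "\<bar>r n - t\<bar>"] by (simp add: dist_real_def)
      then show ?case using N[OF elim(2) r(3)] norm_triangle_lt[of "z (k n) (r n) - z (k n) t" "z (k n) t - g t" e]
        by (simp add: dist_norm)
    qed
  qed
  have gZ: "g \<in> Z"
  proof -
    have pt: "(\<lambda>n. z (k n) t) \<longlonglongrightarrow> g t" if "t \<in> {0..S}" for t by (rule unif) (use that in auto)
    have "(\<lambda>n. \<xi>) \<longlonglongrightarrow> g 0" using pt[of 0] S z0 by simp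
    then have "g 0 = \<xi>" by (simp add: LIMSEQ_const_iff)
    moreover have "norm (g t - g s) \<le> M * (t - s) powr \<alpha>" if "0 \<le> s" "s \<le> t" "t \<le> S" for s t
    proof (rule LIMSEQ_le_const2)
      show "(\<lambda>n. norm (z (k n) t - z (k n) s)) \<longlonglongrightarrow> norm (g t - g s)"
        by (intro tendsto_intros pt) (use that in auto)
    qed (use z_hold[OF that] in auto)
    ultimately show ?thesis by (simp add: ZM path_class_def)
  qed
  obtain N where N': "countable N" "\<forall>t\<in>{0..S} - N. stable_at Z S u g t"
    using stable[OF gZ] by (elim exE conjE)
  then have N: "countable N" "\<And>t. t \<in> {0..S} - N \<Longrightarrow> stable_at Z S u g t" by simp_all
  have v_lim: "(\<lambda>n. v (k n) t) \<longlonglongrightarrow> u g t" if t: "t \<in> {0..S} - N" for t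
  proof -
    \<comment> \<open>These are the paths on which the scheme actually evaluates \<open>u\<close> at
      time \<open>t\<close>. Frozen after the grid time, they approach \<open>g\<close> on
      \<open>[0, t]\<close> but in general not beyond, which is just what
      \<open>converges_before\<close> asks.\<close>
    define w where "w n r = z (k n) (min r (\<tau> (k n) t))" for n r
    have t0: "0 \<le> t" "t \<le> S" using t by auto
    have wZ: "w n \<in> Z" for n unfolding w_def ZM
      by (rule path_class_stopped) (use zZ[unfolded ZM] \<tau> t0 M in auto)
    have "converges_before w g t" unfolding converges_before_def
    proof
      fix s assume s: "s \<in> {0..t}"
      show "(\<lambda>n. w n s) \<longlonglongrightarrow> g s" unfolding w_def
      proof (rule unif)
        show "min s (\<tau> (k n) t) \<in> {0..S}" for n using s t0 \<tau>[OF t0(1), of "k n"] by auto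
        have "(\<lambda>n. min s (\<tau> (k n) t)) \<longlonglongrightarrow> min s t"
          by (intro tendsto_min tendsto_const filterlim_compose[OF \<tau>_lim k_lim] t0)
        then show "(\<lambda>n. min s (\<tau> (k n) t)) \<longlonglongrightarrow> s" using s by simp
      qed (use s t0 in auto)
    qed
    then have "(\<lambda>n. u (w n) t) \<longlonglongrightarrow> u g t" using N(2)[OF t] wZ unfolding stable_at_def by blast
    moreover have "u (w n) t = v (k n) t" for n using wZ[of n] unfolding v V_def w_def by simp
    ultimately show ?thesis by simp
  qed
  define y where "y t = integral {0..t} (u g)" for t
  have neg: "negligible N" using countable_imp_null_set_lborel[OF N(1)] by (simp add: negligible_iff_null_sets null_sets_completionI)
  have x_lim: "(\<lambda>n. x (k n) t) \<longlonglongrightarrow> y t" if t: "t \<in> {0..S}" for t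
  proof -
    \<comment> \<open>Zeroing on the null set \<open>N\<close> yields convergence at every time, as
      the dominated convergence theorem requires.\<close>
    define f where "f n s = (if s \<in> N then 0 else v (k n) s)" for n s
    have vI: "v (k n) integrable_on {0..t}" for n
      by (rule integrable_on_subinterval[OF v_int]) (use t in auto)
    have "(\<lambda>n. integral {0..t} (f n)) \<longlonglongrightarrow> integral {0..t} (\<lambda>s. if s \<in> N then 0 else u g s)"
    proof (rule dominated_convergence(2)[where h = "\<lambda>_. L"])
      show "f n integrable_on {0..t}" for n
        by (rule integrable_spike[OF vI neg]) (auto simp: f_def)
      show "norm (f n s) \<le> L" if "s \<in> {0..t}" for n s using v_bd that t L by (auto simp: f_def)
      show "(\<lambda>n. f n s) \<longlonglongrightarrow> (if s \<in> N then 0 else u g s)" if "s \<in> {0..t}" for s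
        using v_lim[of s] that t by (auto simp: f_def)
    qed (simp add: integrable_const_ivl)
    moreover have "integral {0..t} (f n) = x (k n) t" for n
      unfolding x_def by (rule integral_spike[OF neg]) (auto simp: f_def)
    moreover have "integral {0..t} (\<lambda>s. if s \<in> N then 0 else u g s) = y t"
      unfolding y_def by (rule integral_spike[OF neg]) auto
    ultimately show ?thesis by simp
  qed
  have "norm (germ g y s t) \<le> K * (t - s) powr \<eta>" if st: "0 \<le> s" "s \<le> t" "t \<le> S" for s t
  proof -
    have t0: "0 \<le> t" and sS: "s \<le> S" using st by auto
    define sn tn where "sn n = \<tau> (k n) s" and "tn n = \<tau> (k n) t" for n
    have le: "0 \<le> sn n" "sn n \<le> tn n" "tn n \<le> S" "sn n \<le> s" "tn n \<le> t" "tn n \<le> T" for n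
    proof -
      show "0 \<le> sn n" "tn n \<le> S" "sn n \<le> s" "tn n \<le> t" "tn n \<le> T"
        using \<tau>[OF st(1), of "k n"] \<tau>[OF t0, of "k n"] st S by (auto simp: sn_def tn_def)
      show "sn n \<le> tn n" unfolding sn_def tn_def \<tau>_def
        using h(1)[of "k n"] st by (intro mult_right_mono) (auto intro!: floor_mono divide_right_mono)
    qed
    have sl: "sn \<longlonglongrightarrow> s" and tl: "tn \<longlonglongrightarrow> t" unfolding sn_def tn_def
      using filterlim_compose[OF \<tau>_lim k_lim] st t0 by auto
    have inS: "sn n \<in> {0..S}" "tn n \<in> {0..S}" for n using le[of n] by auto
    have inT: "0 \<le> sn n" "sn n \<le> T" "0 \<le> tn n" "tn n \<le> T" for n using le[of n] by auto
    have zl: "(\<lambda>n. z (k n) (sn n)) \<longlonglongrightarrow> g s" "(\<lambda>n. z (k n) (tn n)) \<longlonglongrightarrow> g t"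
      by (rule unif; use inS sl tl st t0 in simp)+
    \<comment> \<open>The moving end point costs at most \<open>L * (q - r n)\<close> by the common
      Lipschitz bound of the drift integrals.\<close>
    have xl: "(\<lambda>n. x (k n) (r n)) \<longlonglongrightarrow> y q" if r: "r \<longlonglongrightarrow> q" "\<And>n. 0 \<le> r n" "\<And>n. r n \<le> q" "q \<le> S" "0 \<le> q" for r q
    proof -
      have "(\<lambda>n. x (k n) q - x (k n) (r n)) \<longlonglongrightarrow> 0"
      proof (rule Lim_null_comparison)
        show "\<forall>\<^sub>F n in sequentially. norm (x (k n) q - x (k n) (r n)) \<le> L * (q - r n)"
          using x_lip r by simp
        have "(\<lambda>n. L * (q - r n)) \<longlonglongrightarrow> L * (q - q)" by (intro tendsto_intros r)
        then show "(\<lambda>n. L * (q - r n)) \<longlonglongrightarrow> 0" by simp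
      qed
      from tendsto_diff[OF x_lim[of q] this] show ?thesis using r by simp
    qed
    have Xl: "(\<lambda>n. X (sn n)) \<longlonglongrightarrow> X s" "(\<lambda>n. X (tn n)) \<longlonglongrightarrow> X t"
      by (rule continuous_on_tendsto_compose[OF X_cont]; use inT sl tl st t0 S in simp)+
    have "(\<lambda>n. germ (z (k n)) (x (k n)) (sn n) (tn n)) \<longlonglongrightarrow> germ g y s t"
      unfolding germ_def
      by (intro tendsto_diff zl xl Xl sl tl blinfun.tendsto G_tendsto Q_tendsto le inT) (use st t0 S in auto)
    then have "(\<lambda>n. norm (germ (z (k n)) (x (k n)) (sn n) (tn n))) \<longlonglongrightarrow> norm (germ g y s t)"
      by (rule tendsto_norm)
    moreover have "(\<lambda>n. K * (tn n - sn n) powr \<eta>) \<longlonglongrightarrow> K * (t - s) powr \<eta>"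
      using \<eta> le by (intro tendsto_mult tendsto_const tendsto_powr' tendsto_diff sl tl) auto
    moreover have "norm (germ (z (k n)) (x (k n)) (sn n) (tn n)) \<le> K * (tn n - sn n) powr \<eta>" for n
      unfolding sn_def tn_def by (rule grid[OF st])
    ultimately show ?thesis by (intro LIMSEQ_le) auto
  qed
  then show ?thesis using gZ unfolding y_def[abs_def] by blast
qed

end


section \<open>Rough differential inclusions\<close>

context rough_coefficients
begin

text \<open>\<open>K\<close> is fixed first, without reference to \<open>S\<close>; each remaining
  requirement then holds for all sufficiently small \<open>S\<close>. The last one keeps the paths
  of the class inside the ball where \<open>F\<close> is bounded.\<close>

lemma exists_horizon:
  assumes "T > 0" "L > 0"
  obtains S K where "0 < S" "S < T" "S \<le> 1" "K \<ge> 0" "K * S powr (\<eta> - \<alpha>) \<le> 1"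
    "2 powr (1 - \<eta>) * K + 2 * (defect_const L + C^2 * S powr \<alpha> * K) \<le> K"
    "3 * incr_const L * S powr \<alpha> \<le> L * T powr \<alpha>"
proof -
  define \<kappa> where "\<kappa> = 1 - 2 powr (1 - \<eta>)"
  have "2 powr (1 - \<eta>) < 2 powr (0::real)" using \<eta> by (intro powr_less_mono) auto
  then have \<kappa>: "\<kappa> > 0" by (simp add: \<kappa>_def)
  have "defect_const L \<ge> 0"
    using incr_const_ge_1[of L] assms C unfolding defect_const_def by simp
  \<comment> \<open>The contraction leaves a slack of \<open>\<kappa> * K\<close>. One half pays for
    \<open>2 * defect_const L\<close>, the other for the term with
    \<open>S powr \<alpha>\<close>.\<close>
  define K where "K = 4 * defect_const L / \<kappa>"
  have K: "K \<ge> 0" using \<open>defect_const L \<ge> 0\<close> \<kappa> by (simp add: K_def)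
  have small: "\<forall>\<^sub>F S in at_right 0. c * S powr \<beta> \<le> e" if be: "\<beta> > 0" "e > 0" for c \<beta> e :: real
  proof -
    obtain d where "d > 0" "\<And>r. 0 \<le> r \<Longrightarrow> r < d \<Longrightarrow> c * r powr \<beta> < e" using powr_modulus[OF be, of c] by blast
    then show ?thesis by (auto simp: eventually_at_right_field intro!: exI[of _ d] less_imp_le)
  qed
  have "\<forall>\<^sub>F S in at_right 0. K * S powr (\<eta> - \<alpha>) \<le> 1" by (rule small) (use \<eta> in auto)
  moreover have "\<forall>\<^sub>F S in at_right 0. 2 * C^2 * S powr \<alpha> \<le> \<kappa> / 2" by (rule small) (use \<alpha> \<kappa> in auto)
  moreover have "\<forall>\<^sub>F S in at_right 0. 3 * incr_const L * S powr \<alpha> \<le> L * T powr \<alpha>"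
    by (rule small) (use \<alpha> assms in auto)
  moreover have "\<forall>\<^sub>F S in at_right 0. S \<in> {0<..<min 1 T}" using assms by (intro eventually_at_right_real) auto
  ultimately have "\<forall>\<^sub>F S in at_right 0. K * S powr (\<eta> - \<alpha>) \<le> 1 \<and> 2 * C^2 * S powr \<alpha> \<le> \<kappa> / 2 \<and>
     3 * incr_const L * S powr \<alpha> \<le> L * T powr \<alpha> \<and> S \<in> {0<..<min 1 T}" by eventually_elim simp
  then obtain S where S: "K * S powr (\<eta> - \<alpha>) \<le> 1" "2 * C^2 * S powr \<alpha> \<le> \<kappa> / 2"
    "3 * incr_const L * S powr \<alpha> \<le> L * T powr \<alpha>" "0 < S" "S < 1" "S < T"
    using eventually_happens[of _ "at_right (0::real)"] by (auto simp: trivial_limit_at_right_real)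
  have "2 * C^2 * S powr \<alpha> * K \<le> \<kappa> / 2 * K" using S(2) K by (rule mult_right_mono)
  moreover have "2 * defect_const L = \<kappa> / 2 * K" using \<kappa> by (simp add: K_def)
  moreover have "2 powr (1 - \<eta>) * K = K - \<kappa> * K" by (simp add: \<kappa>_def algebra_simps)
  ultimately have "2 powr (1 - \<eta>) * K + 2 * (defect_const L + C^2 * S powr \<alpha> * K) \<le> K" by simp
  then show thesis using S K by (intro that[of S K]) auto
qed

end

section \<open>Tensor algebra and estimates for the coefficient \<open>G\<close>\<close>

lemma norm_tensor_apply_le:
  fixes A :: "(real^'l) \<Rightarrow>\<^sub>L ((real^'l) \<Rightarrow>\<^sub>L 'b::real_normed_vector)"
  shows "norm (tensor_apply A M) \<le> (real CARD('l))^2 * norm A * norm M"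
proof -
  have "norm ((M $ i $ j) *\<^sub>R A (axis i 1) (axis j 1)) \<le> norm A * norm M" for i j
  proof -
    have "\<bar>M $ i $ j\<bar> \<le> norm M"
      using component_le_norm_cart[of "M $ i" j] Finite_Cartesian_Product.norm_nth_le[of M i] by linarith
    moreover have "norm (A (axis i 1) (axis j 1)) \<le> norm A"
      using norm_blinfun[of "A (axis i 1)" "axis j 1"] norm_blinfun[of A "axis i 1"] by (simp add: norm_axis_1)
    ultimately show ?thesis using mult_mono[of "\<bar>M $ i $ j\<bar>" "norm M" "norm (A (axis i 1) (axis j 1))" "norm A"]
      by (simp add: mult.commute)
  qed
  then have "norm (tensor_apply A M) \<le> (\<Sum>i\<in>(UNIV::'l set). \<Sum>j\<in>(UNIV::'l set). norm A * norm M)"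
    unfolding tensor_apply_def by (intro sum_norm_le) auto
  then show ?thesis by (simp add: power2_eq_square algebra_simps)
qed

lemma tensor_apply_add: "tensor_apply A (M + N) = tensor_apply A M + tensor_apply A N"
  by (simp add: tensor_apply_def scaleR_add_left sum.distrib)

lemma tensor_apply_diff_left: "tensor_apply (A - B) M = tensor_apply A M - tensor_apply B M"
  by (simp add: tensor_apply_def blinfun.diff_left scaleR_diff_right sum_subtractf)

lemma has_derivative_deriv_blinfun:
  assumes "G differentiable (at x)"
  shows "(G has_derivative blinfun_apply (deriv_blinfun G x)) (at x)"
proof -
  have "(G has_derivative frechet_derivative G (at x)) (at x)" using assms by (simp add: frechet_derivative_works)
  then show ?thesis unfolding deriv_blinfun_def
    using bounded_linear_Blinfun_apply has_derivative_bounded_linear by metis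
qed

lemma C_b_1_lipschitz:
  assumes "\<And>x. G differentiable (at x)" "\<And>x. norm (deriv_blinfun G x) \<le> g"
  shows "norm (G b - G a) \<le> g * norm (b - a)"
proof (rule differentiable_bound[of UNIV G "\<lambda>x. blinfun_apply (deriv_blinfun G x)"])
  show "onorm (blinfun_apply (deriv_blinfun G x)) \<le> g" for x using assms(2)[of x] by (simp add: norm_blinfun.rep_eq)
qed (use has_derivative_deriv_blinfun[OF assms(1)] in auto)

text \<open>After subtraction of the linear map \<open>deriv_blinfun G a\<close>, the derivative on
  the segment is a difference of derivatives, small by Hoelder continuity; the mean value inequality
  does the rest.\<close>

lemma C_b_1_taylor:
  assumes d: "\<And>x. G differentiable (at x)"
    and h: "\<And>x y. norm (deriv_blinfun G y - deriv_blinfun G x) \<le> g * norm (y - x) powr \<gamma>"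
    and g: "g \<ge> 0" "\<gamma> \<ge> 0"
  shows "norm (G b - G a - deriv_blinfun G a (b - a)) \<le> g * norm (b - a) powr (1 + \<gamma>)"
proof -
  define f where "f y = G y - deriv_blinfun G a y" for y
  have "norm (f b - f a) \<le> (g * norm (b - a) powr \<gamma>) * norm (b - a)"
  proof (rule differentiable_bound[of "closed_segment a b" f "\<lambda>x. blinfun_apply (deriv_blinfun G x - deriv_blinfun G a)"])
    fix y assume y: "y \<in> closed_segment a b"
    have "(f has_derivative (\<lambda>v. deriv_blinfun G y v - deriv_blinfun G a v)) (at y within closed_segment a b)"
      unfolding f_def
      by (intro has_derivative_diff has_derivative_at_withinI[OF has_derivative_deriv_blinfun[OF d]]
          bounded_linear_imp_has_derivative blinfun.bounded_linear_right)
    moreover have "blinfun_apply (deriv_blinfun G y - deriv_blinfun G a) = (\<lambda>v. deriv_blinfun G y v - deriv_blinfun G a v)"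
      by (simp add: fun_eq_iff blinfun.diff_left)
    ultimately show "(f has_derivative blinfun_apply (deriv_blinfun G y - deriv_blinfun G a)) (at y within closed_segment a b)"
      by simp
    have "norm (y - a) \<le> norm (b - a)" using segment_bound(1)[OF y] by simp
    then have "norm (y - a) powr \<gamma> \<le> norm (b - a) powr \<gamma>" using g by (intro powr_mono2) auto
    then have "norm (deriv_blinfun G y - deriv_blinfun G a) \<le> g * norm (b - a) powr \<gamma>"
      using h[of y a] mult_left_mono[OF _ g(1)] order_trans by blast
    then show "onorm (blinfun_apply (deriv_blinfun G y - deriv_blinfun G a)) \<le> g * norm (b - a) powr \<gamma>"
      by (simp add: norm_blinfun.rep_eq)
  qed auto
  moreover have "f b - f a = G b - G a - deriv_blinfun G a (b - a)" by (simp add: f_def blinfun.diff_right)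
  ultimately show ?thesis by (simp add: powr_add mult_ac)
qed

lemma rough_coefficients_of_rough_path:
  fixes X :: "real \<Rightarrow> real^'l" and XX :: "real \<Rightarrow> real \<Rightarrow> real^'l^'l"
    and G :: "real^'d \<Rightarrow> ((real^'l) \<Rightarrow>\<^sub>L (real^'d))"
  assumes \<alpha>: "1/3 < \<alpha>" "\<alpha> \<le> 1/2" and \<gamma>: "0 < \<gamma>" "\<gamma> \<le> 1" and \<alpha>\<gamma>: "\<alpha> * (2 + \<gamma>) > 1"
    and rp: "rough_path \<alpha> T X XX" and Gb: "C_b_1 \<gamma> G"
  shows "\<exists>C. rough_coefficients \<alpha> \<gamma> T C X G (deriv_blinfun G)
    (\<lambda>a s t. tensor_apply (deriv_blinfun G a o\<^sub>L G a) (XX s t))"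
proof -
  define D where "D = deriv_blinfun G"
  obtain cX0 where cX0: "\<forall>s\<in>{0..T}. \<forall>t\<in>{0..T}. norm (X t - X s) \<le> cX0 * dist t s powr \<alpha>"
    using rp unfolding rough_path_def holder_on_def by blast
  have X0: "norm (X t - X s) \<le> cX0 * (t - s) powr \<alpha>" if "0 \<le> s" "s \<le> t" "t \<le> T" for s t
    using cX0[rule_format, of s t] that by (simp add: dist_real_def)
  define cX where "cX = \<bar>cX0\<bar>"
  have X: "norm (X t - X s) \<le> cX * (t - s) powr \<alpha>" if "0 \<le> s" "s \<le> t" "t \<le> T" for s t
    using X0[OF that] mult_right_mono[OF abs_ge_self[of cX0], of "(t - s) powr \<alpha>"] by (simp add: cX_def)
  have chen: "XX r t = XX r s + XX s t + outer (X s - X r) (X t - X s)" if "0 \<le> r" "r \<le> s" "s \<le> t" "t \<le> T" for r s t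
  proof -
    have "XX r t - XX r s - XX s t = outer (X s - X r) (X t - X s)" using rp that by (simp add: rough_path_def)
    then show ?thesis by (simp add: algebra_simps)
  qed
  \<comment> \<open>The order estimate says nothing on the diagonal; there Chen's relation with
    three equal times forces the value zero.\<close>
  have XX0: "XX s s = 0" if "0 \<le> s" "s \<le> T" for s
    using chen[of s s s] that by (simp add: outer_def vec_eq_iff)
  obtain c0 where c0: "\<forall>s\<in>{0..T}. \<forall>t\<in>{0..T}. s \<noteq> t \<longrightarrow> norm (XX s t) / \<bar>t - s\<bar> powr (2 * \<alpha>) \<le> c0"
    using rp unfolding rough_path_def two_param_order_on_def by blast
  define cQ where "cQ = \<bar>c0\<bar>"
  have XX: "norm (XX s t) \<le> cQ * (t - s) powr (2 * \<alpha>)" if st: "0 \<le> s" "s \<le> t" "t \<le> T" for s t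
  proof (cases "s = t")
    case True
    then show ?thesis using XX0 st by simp
  next
    case False
    then have "norm (XX s t) / (t - s) powr (2 * \<alpha>) \<le> cQ" using c0 st unfolding cQ_def by force
    then show ?thesis using False st by (simp add: divide_le_eq)
  qed
  obtain g0 where g0: "\<And>x. norm (G x) \<le> g0"
    using Gb unfolding C_b_1_def bounded_iff by auto
  obtain g1 where g1: "\<And>x. norm (D x) \<le> g1"
    using Gb unfolding C_b_1_def bounded_iff D_def by auto
  obtain g2' where "\<forall>x y. norm (D y - D x) \<le> g2' * dist y x powr \<gamma>"
    using Gb unfolding C_b_1_def holder_on_def D_def by auto
  then have g2'': "norm (D y - D x) \<le> g2' * norm (y - x) powr \<gamma>" for x y by (simp add: dist_norm)
  define g2 where "g2 = \<bar>g2'\<bar>"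
  have g2: "norm (D y - D x) \<le> g2 * norm (y - x) powr \<gamma>" for x y
    using g2''[of y x] mult_right_mono[OF abs_ge_self[of g2'], of "norm (y - x) powr \<gamma>"] by (simp add: g2_def)
  have nn: "g0 \<ge> 0" "g1 \<ge> 0" "g2 \<ge> 0" "cX \<ge> 0" "cQ \<ge> 0"
    using order_trans[OF norm_ge_zero g0[of 0]] order_trans[OF norm_ge_zero g1[of 0]]
    by (simp_all add: g2_def cX_def cQ_def)
  have diff: "\<And>x. G differentiable (at x)" using Gb by (simp add: C_b_1_def)
  have lip: "norm (G b - G a) \<le> g1 * norm (b - a)" for a b
    by (rule C_b_1_lipschitz[OF diff]) (use g1 in \<open>simp add: D_def\<close>)
  have taylor: "norm (G b - G a - D a (b - a)) \<le> g2 * norm (b - a) powr (1 + \<gamma>)" for a b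
    unfolding D_def by (rule C_b_1_taylor[OF diff]) (use g2 nn \<gamma> in \<open>simp_all add: D_def\<close>)
  \<comment> \<open>Lipschitz continuity gives the Hoelder bound at distances up to 1 and
    boundedness gives it beyond. It is needed for the product \<open>DG a o\<^sub>L G a\<close> to
    be \<gamma>-Hoelder on the whole space.\<close>
  have G_hold: "norm (G b - G a) \<le> (2 * g0 + g1) * norm (b - a) powr \<gamma>" for a b
  proof (cases "norm (b - a) \<le> 1")
    case True
    have "norm (b - a) powr 1 \<le> norm (b - a) powr \<gamma>" using True \<gamma> by (intro powr_mono') auto
    then have "g1 * norm (b - a) \<le> g1 * norm (b - a) powr \<gamma>" using nn by (intro mult_left_mono) auto
    also have "\<dots> \<le> (2 * g0 + g1) * norm (b - a) powr \<gamma>" using nn by (intro mult_right_mono) auto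
    finally show ?thesis using lip[of b a] by linarith
  next
    case False
    then have "1 \<le> norm (b - a) powr \<gamma>" using \<gamma> by (intro ge_one_powr_ge_zero) auto
    then have "(2 * g0 + g1) * 1 \<le> (2 * g0 + g1) * norm (b - a) powr \<gamma>" using nn by (intro mult_left_mono) auto
    moreover have "norm (G b - G a) \<le> 2 * g0" using norm_triangle_ineq4[of "G b" "G a"] g0[of a] g0[of b] by linarith
    moreover have "2 * g0 \<le> (2 * g0 + g1) * 1" using nn by simp
    ultimately show ?thesis by (meson order_trans)
  qed
  define A where "A = g2 * g0 + g1 * (2 * g0 + g1)"
  have comp: "norm ((D b o\<^sub>L G b) - (D a o\<^sub>L G a)) \<le> A * norm (b - a) powr \<gamma>" for a b
  proof -
    have "(D b o\<^sub>L G b) - (D a o\<^sub>L G a) = ((D b - D a) o\<^sub>L G b) + (D a o\<^sub>L (G b - G a))"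
      by (rule blinfun_eqI) (simp add: blinfun.diff_left blinfun.add_left blinfun.diff_right)
    then have "norm ((D b o\<^sub>L G b) - (D a o\<^sub>L G a)) \<le> norm ((D b - D a) o\<^sub>L G b) + norm (D a o\<^sub>L (G b - G a))"
      by (metis norm_triangle_ineq)
    also have "\<dots> \<le> (g2 * norm (b - a) powr \<gamma>) * g0 + g1 * ((2 * g0 + g1) * norm (b - a) powr \<gamma>)"
      by (rule add_mono; rule order_trans[OF norm_blinfun_compose], rule mult_mono)
        (use g0 g1 g2 G_hold nn in auto)
    also have "\<dots> = A * norm (b - a) powr \<gamma>" by (simp add: A_def algebra_simps)
    finally show ?thesis .
  qed
  have comp0: "norm (D a o\<^sub>L G a) \<le> g1 * g0" for a
    by (rule order_trans[OF norm_blinfun_compose], rule mult_mono) (use g0 g1 nn in auto)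
  define c where "c = (real CARD('l))^2"
  have c: "c \<ge> 0" by (simp add: c_def)
  have A0: "A \<ge> 0" using nn by (simp add: A_def)
  define C where "C = 1 + cX + c * (g1 * g0) * cQ + c * A * cQ + g0 + g1 + g2"
  have p: "c * (g1 * g0) * cQ \<ge> 0" "c * A * cQ \<ge> 0" using nn c A0 by simp_all
  have C: "1 \<le> C" "cX \<le> C" "c * (g1 * g0) * cQ \<le> C" "c * A * cQ \<le> C" "g0 \<le> C" "g1 \<le> C" "g2 \<le> C"
    using nn p unfolding C_def by linarith+
  have "rough_coefficients \<alpha> \<gamma> T C X G D (\<lambda>a s t. tensor_apply (D a o\<^sub>L G a) (XX s t))"
  proof (unfold_locales)
    fix s t assume st: "0 \<le> s" "s \<le> t" "t \<le> T"
    show "norm (X t - X s) \<le> C * (t - s) powr \<alpha>"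
      using X[OF st] mult_right_mono[OF C(2), of "(t - s) powr \<alpha>"] by simp
    show "norm (tensor_apply (D a o\<^sub>L G a) (XX s t)) \<le> C * (t - s) powr (2 * \<alpha>)" for a
    proof -
      have "norm (tensor_apply (D a o\<^sub>L G a) (XX s t)) \<le> c * norm (D a o\<^sub>L G a) * norm (XX s t)"
        unfolding c_def by (rule norm_tensor_apply_le)
      also have "\<dots> \<le> c * (g1 * g0) * (cQ * (t - s) powr (2 * \<alpha>))"
        using c comp0 XX[OF st] nn by (intro mult_mono) auto
      also have "\<dots> = c * (g1 * g0) * cQ * (t - s) powr (2 * \<alpha>)" by simp
      also have "\<dots> \<le> C * (t - s) powr (2 * \<alpha>)" by (rule mult_right_mono[OF C(3)]) simp
      finally show ?thesis .
    qed
    show "norm (tensor_apply (D b o\<^sub>L G b) (XX s t) - tensor_apply (D a o\<^sub>L G a) (XX s t))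
      \<le> C * norm (b - a) powr \<gamma> * (t - s) powr (2 * \<alpha>)" for a b
    proof -
      have "norm (tensor_apply (D b o\<^sub>L G b) (XX s t) - tensor_apply (D a o\<^sub>L G a) (XX s t))
         \<le> c * norm ((D b o\<^sub>L G b) - (D a o\<^sub>L G a)) * norm (XX s t)"
        unfolding c_def tensor_apply_diff_left[symmetric] by (rule norm_tensor_apply_le)
      also have "\<dots> \<le> c * (A * norm (b - a) powr \<gamma>) * (cQ * (t - s) powr (2 * \<alpha>))"
        using c comp XX[OF st] nn A0 by (intro mult_mono) auto
      also have "\<dots> = c * A * cQ * (norm (b - a) powr \<gamma> * (t - s) powr (2 * \<alpha>))" by simp
      also have "\<dots> \<le> C * (norm (b - a) powr \<gamma> * (t - s) powr (2 * \<alpha>))" by (rule mult_right_mono[OF C(4)]) simp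
      finally show ?thesis by simp
    qed
  next
    fix r s t :: real and a assume "0 \<le> r" "r \<le> s" "s \<le> t" "t \<le> T"
    then show "tensor_apply (D a o\<^sub>L G a) (XX r t) = tensor_apply (D a o\<^sub>L G a) (XX r s)
      + tensor_apply (D a o\<^sub>L G a) (XX s t) + D a (G a (X s - X r)) (X t - X s)"
      using chen[of r s t] by (simp add: tensor_apply_add tensor_apply_outer)
  next
    fix a b
    show "norm (G a) \<le> C" "norm (D a) \<le> C" using g0[of a] g1[of a] C by linarith+
    show "norm (G b - G a) \<le> C * norm (b - a)"
      using lip[of b a] mult_right_mono[OF C(6), of "norm (b - a)"] by simp
    show "norm (G b - G a - D a (b - a)) \<le> C * norm (b - a) powr (1 + \<gamma>)"
      using taylor[of b a] mult_right_mono[OF C(7), of "norm (b - a) powr (1 + \<gamma>)"] by simp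
  qed (use \<alpha> \<gamma> \<alpha>\<gamma> C in auto)
  then show ?thesis unfolding D_def by blast
qed

text \<open>The candidate integral is already at hand as increments of \<open>w\<close>, so
  convergence reduces to summing local errors: each is at most the mesh to the power
  \<open>\<eta> - 1\<close> times the length of its interval, up to the factor
  \<open>K\<close>.\<close>

lemma has_rough_integral_of_local_estimate:
  fixes y :: "real \<Rightarrow> (real^'l) \<Rightarrow>\<^sub>L 'b::real_normed_vector"
  assumes est: "\<And>s t. 0 \<le> s \<Longrightarrow> s \<le> t \<Longrightarrow> t \<le> S \<Longrightarrow>
      norm (w t - w s - (y s (X t - X s) + tensor_apply (y' s) (XX s t))) \<le> K * (t - s) powr \<eta>"
    and \<eta>: "\<eta> > 1" and K: "K \<ge> 0" and t: "t \<in> {0..S}"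
  shows "has_rough_integral X XX y y' 0 t (w t - w 0)"
  unfolding has_rough_integral_def
proof (intro allI impI)
  fix \<epsilon> :: real assume "\<epsilon> > 0"
  then obtain d where d: "d > 0" "\<And>r. 0 \<le> r \<Longrightarrow> r < d \<Longrightarrow> K * S * r powr (\<eta> - 1) < \<epsilon>"
    using powr_modulus[of "\<eta> - 1" \<epsilon> "K * S"] \<eta> by auto
  \<comment> \<open>Halving gives an admissible argument for the strict modulus; it then bounds all
    smaller mesh sizes by monotonicity.\<close>
  define \<delta> where "\<delta> = d / 2"
  have \<delta>: "\<delta> > 0" "K * S * \<delta> powr (\<eta> - 1) < \<epsilon>" using d(1) d(2)[of \<delta>] by (auto simp: \<delta>_def)
  have "norm ((\<Sum>i<n. y (p i) (X (p (Suc i)) - X (p i)) + tensor_apply (y' (p i)) (XX (p i) (p (Suc i)))) - (w t - w 0)) < \<epsilon>"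
    if p: "p 0 = 0" "p n = t" "\<And>i. i < n \<Longrightarrow> p i < p (Suc i)" "\<And>i. i < n \<Longrightarrow> p (Suc i) - p i < \<delta>"
    for n and p :: "nat \<Rightarrow> real"
  proof -
    have mono: "p i \<le> p j" if "i \<le> j" "j \<le> n" for i j
      using that
    proof (induction j rule: dec_induct)
      case (step m)
      then show ?case using p(3)[of m] by simp
    qed simp
    have p0: "0 \<le> p i" "p i \<le> t" if "i \<le> n" for i using mono[of 0 i] mono[of i n] p that by auto
    define E where "E i = w (p (Suc i)) - w (p i)
      - (y (p i) (X (p (Suc i)) - X (p i)) + tensor_apply (y' (p i)) (XX (p i) (p (Suc i))))" for i
    have "(\<Sum>i<n. w (p (Suc i)) - w (p i)) = w t - w 0"
      using sum_lessThan_telescope[of "\<lambda>i. w (p i)" n] by (simp add: p(1,2))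
    then have "(\<Sum>i<n. y (p i) (X (p (Suc i)) - X (p i)) + tensor_apply (y' (p i)) (XX (p i) (p (Suc i)))) - (w t - w 0)
      = - (\<Sum>i<n. E i)" by (simp add: E_def sum_subtractf)
    then have "norm ((\<Sum>i<n. y (p i) (X (p (Suc i)) - X (p i)) + tensor_apply (y' (p i)) (XX (p i) (p (Suc i)))) - (w t - w 0))
      = norm (\<Sum>i<n. E i)" by simp
    also have "\<dots> \<le> (\<Sum>i<n. K * \<delta> powr (\<eta> - 1) * (p (Suc i) - p i))"
    proof (rule sum_norm_le)
      fix i assume "i \<in> {..<n}"
      then have i: "i < n" by simp
      define r where "r = p (Suc i) - p i"
      have r: "0 < r" "r < \<delta>" using p(3,4)[OF i] by (auto simp: r_def)
      have "norm (E i) \<le> K * r powr \<eta>" unfolding E_def r_def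
        by (rule est) (use p0[of i] p0[of "Suc i"] p(3)[OF i] i t in auto)
      also have "r powr \<eta> = r powr (\<eta> - 1) * r" using r by (simp add: powr_diff)
      also have "K * (r powr (\<eta> - 1) * r) \<le> K * (\<delta> powr (\<eta> - 1) * r)"
        using r \<eta> K by (intro mult_left_mono mult_right_mono powr_mono2) auto
      finally show "norm (E i) \<le> K * \<delta> powr (\<eta> - 1) * (p (Suc i) - p i)" by (simp add: r_def mult.assoc)
    qed
    also have "\<dots> = K * \<delta> powr (\<eta> - 1) * t"
      using sum_lessThan_telescope[of p n] by (simp add: p(1,2) sum_distrib_left[symmetric])
    also have "\<dots> \<le> K * \<delta> powr (\<eta> - 1) * S" using K t by (intro mult_left_mono) auto
    also have "\<dots> < \<epsilon>" using \<delta>(2) by (simp add: mult_ac)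
    finally show ?thesis .
  qed
  then show "\<exists>\<delta>>0. \<forall>n p. p 0 = 0 \<and> p n = t \<and> (\<forall>i<n. p i < p (Suc i) \<and> p (Suc i) - p i < \<delta>) \<longrightarrow>
      norm ((\<Sum>i<n. y (p i) (X (p (Suc i)) - X (p i)) + tensor_apply (y' (p i)) (XX (p i) (p (Suc i)))) - (w t - w 0)) < \<epsilon>"
    using \<delta>(1) by (intro exI[of _ \<delta>]) simp
qed

lemma lipschitz_imp_abs_continuous_on:
  assumes "\<And>s t. 0 \<le> s \<Longrightarrow> s \<le> t \<Longrightarrow> t \<le> S \<Longrightarrow> norm (x t - x s) \<le> L * (t - s)" "L > 0"
  shows "abs_continuous_on {0..S} x"
  unfolding abs_continuous_on_def
proof (intro allI impI)
  fix \<epsilon> :: real assume \<epsilon>: "\<epsilon> > 0"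
  have main: "(\<Sum>i<n. norm (x (b i) - x (a i))) < \<epsilon>"
    if ab: "\<forall>i<n. a i \<le> b i \<and> {a i..b i} \<subseteq> {0..S}" and small: "(\<Sum>i<n. b i - a i) < \<epsilon> / L" for n :: nat and a b
  proof -
    have "(\<Sum>i<n. norm (x (b i) - x (a i))) \<le> (\<Sum>i<n. L * (b i - a i))"
      using ab by (intro sum_mono assms(1)) auto
    also have "\<dots> = L * (\<Sum>i<n. b i - a i)" by (simp add: sum_distrib_left)
    also have "\<dots> < \<epsilon>" using small assms(2) by (simp add: field_simps)
    finally show ?thesis .
  qed
  show "\<exists>\<delta>>0. \<forall>(n::nat) a b. (\<forall>i<n. a i \<le> b i \<and> {a i..b i} \<subseteq> {0..S}) \<and>
      disjoint_family_on (\<lambda>i. {a i<..<b i}) {..<n} \<and> (\<Sum>i<n. b i - a i) < \<delta> \<longrightarrow>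
      (\<Sum>i<n. norm (x (b i) - x (a i))) < \<epsilon>"
  proof (intro exI[of _ "\<epsilon> / L"] conjI allI impI)
    show "\<epsilon> / L > 0" using \<epsilon> assms(2) by simp
    fix n :: nat and a b assume "(\<forall>i<n. a i \<le> b i \<and> {a i..b i} \<subseteq> {0..S}) \<and>
      disjoint_family_on (\<lambda>i. {a i<..<b i}) {..<n} \<and> (\<Sum>i<n. b i - a i) < \<epsilon> / L"
    then show "(\<Sum>i<n. norm (x (b i) - x (a i))) < \<epsilon>" by (intro main) blast+
  qed
qed

context rough_coefficients
begin

text \<open>With \<open>G (z s)\<close> as derivative, the remainder is germ plus drift plus second
  order term, and each has order at least \<open>2 * \<alpha>\<close> on a horizon of length at most
  1.\<close>

lemma controlled_path_of_germ_bound: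
  assumes S: "S \<le> T" "S \<le> 1" and K: "K \<ge> 0" and L: "L \<ge> 0" and M: "M \<ge> 0" and z: "z \<in> path_class M S \<xi>"
    and x: "\<And>s t. 0 \<le> s \<Longrightarrow> s \<le> t \<Longrightarrow> t \<le> S \<Longrightarrow> norm (x t - x s) \<le> L * (t - s)"
    and germ: "\<And>s t. 0 \<le> s \<Longrightarrow> s \<le> t \<Longrightarrow> t \<le> S \<Longrightarrow> norm (germ z x s t) \<le> K * (t - s) powr \<eta>"
  shows "controlled_path \<alpha> (2 * \<alpha>) S X z (\<lambda>s. G (z s))"
  unfolding controlled_path_def
proof (intro conjI)
  have zh: "norm (z t - z s) \<le> M * (t - s) powr \<alpha>" if "0 \<le> s" "s \<le> t" "t \<le> S" for s t
    using z that by (simp add: path_class_def)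
  have zh': "norm (z t - z s) \<le> M * dist t s powr \<alpha>" if "s \<in> {0..S}" "t \<in> {0..S}" for s t
    using zh[of s t] zh[of t s] that by (cases "s \<le> t") (auto simp: dist_real_def norm_minus_commute)
  have Gz: "norm (G (z t) - G (z s)) \<le> C * M * dist t s powr \<alpha>" if "s \<in> {0..S}" "t \<in> {0..S}" for s t
    using order_trans[OF G_lip mult_left_mono[OF zh'[OF that], of C]] C by (simp add: mult.assoc)
  show "\<alpha> < 2 * \<alpha>" using \<alpha> by simp
  show "holder_on \<alpha> {0..S} z" unfolding holder_on_def using zh' by blast
  show "holder_on (2 * \<alpha> - \<alpha>) {0..S} (\<lambda>s. G (z s))" unfolding holder_on_def using Gz by (intro exI[of _ "C * M"]) simp
  define R where "R s t = z t - z s - G (z s) (X t - X s)" for s t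
  define c where "c = L + C + K"
  have c: "c \<ge> 0" using L C K by (simp add: c_def)
  have R1: "norm (R s t) \<le> c * (t - s) powr (2 * \<alpha>)" if st: "0 \<le> s" "s \<le> t" "t \<le> S" for s t
  proof -
    define d where "d = t - s"
    have d: "0 \<le> d" "d \<le> 1" using st S by (auto simp: d_def)
    have "2 * \<alpha> \<le> \<eta>" using \<alpha> \<gamma> by (simp add: \<eta>_def algebra_simps)
    then have p: "d powr \<eta> \<le> d powr (2 * \<alpha>)" using d by (intro powr_mono') auto
    have "R s t = germ z x s t + (x t - x s) + Q (z s) s t" by (simp add: R_def germ_def)
    then have "norm (R s t) \<le> norm (germ z x s t) + norm (x t - x s) + norm (Q (z s) s t)"
      by (metis norm_triangle_mono order_refl)
    also have "\<dots> \<le> K * d powr (2 * \<alpha>) + L * d powr (2 * \<alpha>) + C * d powr (2 * \<alpha>)"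
    proof (intro add_mono)
      show "norm (germ z x s t) \<le> K * d powr (2 * \<alpha>)"
        using germ[OF st] mult_left_mono[OF p K] by (simp add: d_def)
      show "norm (x t - x s) \<le> L * d powr (2 * \<alpha>)"
        using x[OF st] mult_left_mono[OF powr_le_\<alpha>(3)[OF d] L] by (simp add: d_def)
      show "norm (Q (z s) s t) \<le> C * d powr (2 * \<alpha>)" unfolding d_def by (rule Q) (use st S in auto)
    qed
    finally show ?thesis by (simp add: c_def d_def algebra_simps)
  qed
  \<comment> \<open>The remainder must be bounded for both orders of the two times. Reversing them
    changes the base point of \<open>G (z s)\<close>, and the product of the two Hoelder increments
    again has order \<open>2 * \<alpha>\<close>.\<close>
  have R2: "norm (R s t) \<le> (c + C * M * C) * \<bar>t - s\<bar> powr (2 * \<alpha>)" if st: "s \<in> {0..S}" "t \<in> {0..S}" for s t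
  proof (cases "s \<le> t")
    case True
    have "c * (t - s) powr (2 * \<alpha>) \<le> (c + C * M * C) * (t - s) powr (2 * \<alpha>)"
      using C M by (intro mult_right_mono) auto
    then show ?thesis using R1[of s t] st True by simp
  next
    case False
    then have ts: "0 \<le> t" "t \<le> s" "s \<le> S" using st by auto
    have "R s t = (G (z s) - G (z t)) (X s - X t) - R t s"
      by (simp add: R_def blinfun.diff_left blinfun.diff_right)
    then have "norm (R s t) \<le> norm ((G (z s) - G (z t)) (X s - X t)) + norm (R t s)"
      by (metis norm_triangle_ineq4)
    also have "\<dots> \<le> (C * M * (s - t) powr \<alpha>) * (C * (s - t) powr \<alpha>) + c * (s - t) powr (2 * \<alpha>)"
    proof (rule add_mono[OF _ R1[OF ts]])
      show "norm ((G (z s) - G (z t)) (X s - X t)) \<le> (C * M * (s - t) powr \<alpha>) * (C * (s - t) powr \<alpha>)"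
        by (rule order_trans[OF norm_blinfun], rule mult_mono)
          (use Gz[OF st(2,1)] X[of t s] ts S C M in \<open>auto simp: dist_real_def\<close>)
    qed
    also have "\<dots> = (c + C * M * C) * ((s - t) powr \<alpha> * (s - t) powr \<alpha>)" by (simp add: algebra_simps flip: powr_add)
    finally show ?thesis using ts by (simp flip: powr_add)
  qed
  have "two_param_order_on (2 * \<alpha>) {0..S} R" unfolding two_param_order_on_def
  proof (intro exI ballI impI)
    fix s t assume "s \<in> {0..S}" "t \<in> {0..S}" "s \<noteq> t"
    then show "norm (R s t) / \<bar>t - s\<bar> powr (2 * \<alpha>) \<le> c + C * M * C"
      using R2[of s t] by (simp add: divide_le_eq)
  qed
  then show "\<exists>R. two_param_order_on (2 * \<alpha>) {0..S} R \<and>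
      (\<forall>s\<in>{0..S}. \<forall>t\<in>{0..S}. z t - z s = G (z s) (X t - X s) + R s t)"
    by (intro exI[of _ R]) (simp add: R_def)
qed

end

theorem theorem1p4:
  fixes T \<alpha> \<gamma> L :: real and \<xi> :: "real^'d"
    and X :: "real \<Rightarrow> real^'l" and XX :: "real \<Rightarrow> real \<Rightarrow> real^'l^'l"
    and G :: "real^'d \<Rightarrow> ((real^'l) \<Rightarrow>\<^sub>L (real^'d))"
    and \<Omega> :: "(real \<times> (real^'d)) set" and F :: "real \<times> (real^'d) \<Rightarrow> (real^'d) set"
  assumes "T > 0"
    and "1/3 < \<alpha>" and "\<alpha> \<le> 1/2"
    and "weak_geometric_rough_path \<alpha> T X XX"
    and "0 \<le> \<gamma>" and "\<gamma> \<le> 1" and "\<alpha> * (2 + \<gamma>) > 1"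
    and "C_b_1 \<gamma> G"
    and "closed \<Omega>"
    and "lower_semicontinuous_on \<Omega> F"
    and "\<And>p. p \<in> \<Omega> \<Longrightarrow> compact (F p) \<and> F p \<noteq> {}"
    and "L > 0"
    and "{0..T} \<times> cball \<xi> (L * T powr \<alpha>) \<subseteq> \<Omega>"
    and "\<And>t a w. t \<in> {0..T} \<Longrightarrow> a \<in> cball \<xi> (L * T powr \<alpha>) \<Longrightarrow> w \<in> F (t, a) \<Longrightarrow> norm w \<le> L"
  shows "\<exists>Tstar z. 0 < Tstar \<and> Tstar < T \<and> rdi_solution \<alpha> X XX \<Omega> F G \<xi> Tstar z"
proof -
  \<comment> \<open>With \<open>\<alpha> \<le> 1/2\<close>, the value \<open>\<gamma> = 0\<close>
    would give \<open>\<alpha> * (2 + \<gamma>) \<le> 1\<close>.\<close>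
  have \<gamma>: "\<gamma> > 0"
  proof (rule ccontr)
    assume "\<not> \<gamma> > 0"
    then have "\<gamma> = 0" using assms(5) by simp
    then show False using assms(3,7) by simp
  qed
  have "rough_path \<alpha> T X XX" using assms(4) by (simp add: weak_geometric_rough_path_def)
  then obtain C where "rough_coefficients \<alpha> \<gamma> T C X G (deriv_blinfun G)
      (\<lambda>a s t. tensor_apply (deriv_blinfun G a o\<^sub>L G a) (XX s t))"
    using rough_coefficients_of_rough_path[OF assms(2,3) \<gamma> assms(6,7) _ assms(8)] by blast
  then interpret rough_coefficients \<alpha> \<gamma> T C X G "deriv_blinfun G"
    "\<lambda>a s t. tensor_apply (deriv_blinfun G a o\<^sub>L G a) (XX s t)" .
  obtain S K where S: "0 < S" "S < T" "S \<le> 1" and K: "K \<ge> 0" "K * S powr (\<eta> - \<alpha>) \<le> 1"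
    "2 powr (1 - \<eta>) * K + 2 * (defect_const L + C^2 * S powr \<alpha> * K) \<le> K"
    and ball: "3 * incr_const L * S powr \<alpha> \<le> L * T powr \<alpha>"
    using exists_horizon[OF assms(1,12)] by blast
  define M where "M = 3 * incr_const L"
  have L: "L \<ge> 0" using assms(12) by simp
  have M: "M \<ge> 0" using incr_const_ge_1[OF L] by (simp add: M_def)
  define Z where "Z = path_class M S \<xi>"
  define K0 where "K0 = {0..S} \<times> cball \<xi> (L * T powr \<alpha>)"
  have K0: "compact K0" "K0 \<subseteq> \<Omega>" using assms(13) S by (auto simp: K0_def compact_Times)
  have F: "closed (F p) \<and> F p \<noteq> {}" if "p \<in> K0" for p
    using assms(11)[of p] K0 that compact_imp_closed by blast
  have FL: "norm w \<le> L" if p: "p \<in> K0" and w: "w \<in> F p" for p w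
  proof -
    obtain t a where [simp]: "p = (t, a)" by fastforce
    show ?thesis by (rule assms(14)[of t a w]) (use p w S in \<open>auto simp: K0_def\<close>)
  qed
  have zh: "norm (z t - z s) \<le> M * (t - s) powr \<alpha>" if "z \<in> Z" "0 \<le> s" "s \<le> t" "t \<le> S" for z s t
    using that by (simp add: Z_def path_class_def)
  have ZK: "(t, z t) \<in> K0" if z: "z \<in> Z" and t: "t \<in> {0..S}" for z t
  proof -
    have "norm (z t - \<xi>) \<le> M * (t - 0) powr \<alpha>" using zh[OF z, of 0 t] z t by (simp add: Z_def path_class_def)
    also have "\<dots> \<le> M * S powr \<alpha>" using M t \<alpha> by (intro mult_left_mono powr_mono2) auto
    finally show ?thesis using ball t by (simp add: K0_def dist_norm norm_minus_commute M_def)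
  qed
  have equi: "\<exists>d>0. \<forall>z\<in>Z. \<forall>s\<in>{0..S}. \<forall>t\<in>{0..S}. \<bar>t - s\<bar> < d \<longrightarrow> dist (z s) (z t) < e" if e: "e > 0" for e
  proof -
    obtain d where d: "d > 0" "\<And>r. 0 \<le> r \<Longrightarrow> r < d \<Longrightarrow> M * r powr \<alpha> < e"
      using powr_modulus[OF _ e, of \<alpha> M] \<alpha> by auto
    have "dist (z s) (z t) < e" if "z \<in> Z" "s \<in> {0..S}" "t \<in> {0..S}" "\<bar>t - s\<bar> < d" for z s t
      using zh[OF that(1), of s t] zh[OF that(1), of t s] d(2)[of "\<bar>t - s\<bar>"] that
      by (cases "s \<le> t") (auto simp: dist_norm norm_minus_commute)
    then show ?thesis using d(1) by blast
  qed
  have "\<exists>u. (\<forall>z\<in>Z. \<forall>t\<in>{0..S}. u z t \<in> F (t, z t)) \<and>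
      (\<forall>z\<in>Z. \<exists>N. countable N \<and> (\<forall>t\<in>{0..S} - N. stable_at Z S u z t))"
    by (rule path_dependent_selection[OF assms(10) K0 F L FL]) (use ZK equi in auto)
  then obtain u where u': "\<forall>z\<in>Z. \<forall>t\<in>{0..S}. u z t \<in> F (t, z t)"
    and stable: "\<forall>z\<in>Z. \<exists>N. countable N \<and> (\<forall>t\<in>{0..S} - N. stable_at Z S u z t)"
    by (elim exE conjE)
  have u: "u z t \<in> F (t, z t)" "norm (u z t) \<le> L" if "z \<in> Z" "t \<in> {0..S}" for z t
    using u' FL[OF ZK[OF that]] that by auto
  have "\<exists>z\<in>Z. \<forall>s t. 0 \<le> s \<longrightarrow> s \<le> t \<longrightarrow> t \<le> S \<longrightarrow>
      norm (germ z (\<lambda>t. integral {0..t} (u z)) s t) \<le> K * (t - s) powr \<eta>"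
    by (rule exists_rough_solution[OF S(1) less_imp_le[OF S(2)] S(3) L K])
      (use u stable in \<open>auto simp: Z_def M_def\<close>)
  then obtain z where z: "z \<in> Z" and germ': "\<forall>s t. 0 \<le> s \<longrightarrow> s \<le> t \<longrightarrow> t \<le> S \<longrightarrow>
      norm (germ z (\<lambda>t. integral {0..t} (u z)) s t) \<le> K * (t - s) powr \<eta>" by (elim bexE)
  define x where "x t = integral {0..t} (u z)" for t
  have germ: "norm (germ z x s t) \<le> K * (t - s) powr \<eta>" if "0 \<le> s" "s \<le> t" "t \<le> S" for s t
    using germ' that unfolding x_def[abs_def] by simp
  obtain N where N: "countable N" "\<forall>t\<in>{0..S} - N. stable_at Z S u z t"
    using stable[rule_format, OF z] by (elim exE conjE)
  have cont: "continuous (at t within {0..S}) (u z)" if "t \<in> {0..S} - N" for t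
    using N(2) that by (simp add: stable_at_def)
  have u_int: "u z integrable_on {0..S}"
    by (rule integrable_on_bounded_continuous_countable_exceptions[OF N(1) cont u(2)[OF z]])
  have x_lip: "norm (x t - x s) \<le> L * (t - s)" if "0 \<le> s" "s \<le> t" "t \<le> S" for s t
    unfolding x_def by (rule integral_increment_bound[OF u_int u(2)[OF z] L that])
  have x0: "x 0 = 0" by (simp add: x_def)
  have z0: "z 0 = \<xi>" using z by (simp add: Z_def path_class_def)
  have "N \<in> null_sets lebesgue" using countable_imp_null_set_lborel[OF N(1)] by (rule null_sets_completionI)
  then have "AE t in lebesgue. t \<notin> N" by (rule AE_not_in)
  then have "AE t in lebesgue. t \<in> {0..S} \<longrightarrow> (\<exists>v\<in>F (t, z t). (x has_vector_derivative v) (at t within {0..S}))"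
  proof eventually_elim
    case (elim t)
    show ?case
    proof
      assume t: "t \<in> {0..S}"
      \<comment> \<open>The integral is differentiable wherever its integrand is continuous, hence
        off the countable set \<open>N\<close>, and there the derivative is the selected element of
        \<open>F (t, z t)\<close>.\<close>
      have "(x has_vector_derivative u z t) (at t within {0..S})"
        using integral_has_vector_derivative_continuous_at[OF u_int, of t "{}"] cont[of t] t elim
        by (simp add: x_def[abs_def])
      then show "\<exists>v\<in>F (t, z t). (x has_vector_derivative v) (at t within {0..S})" using u(1)[OF z t] by blast
    qed
  qed
  then have AE: "AE t in lebesgue_on {0..S}. \<exists>v\<in>F (t, z t). (x has_vector_derivative v) (at t within {0..S})"
    by (subst AE_restrict_space_iff) auto
  have ri: "has_rough_integral X XX (\<lambda>s. G (z s)) (\<lambda>s. deriv_blinfun G (z s) o\<^sub>L G (z s)) 0 t (z t - \<xi> - x t)"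
    if t: "t \<in> {0..S}" for t
  proof -
    \<comment> \<open>The candidate integral is \<open>z - x\<close>: its increments differ from the
      compensated Riemann summands exactly by the germ.\<close>
    have "has_rough_integral X XX (\<lambda>s. G (z s)) (\<lambda>s. deriv_blinfun G (z s) o\<^sub>L G (z s)) 0 t ((z t - x t) - (z 0 - x 0))"
    proof (rule has_rough_integral_of_local_estimate[OF _ \<eta>(1) K(1) t])
      fix s t assume "0 \<le> s" "s \<le> t" "t \<le> S"
      from germ[OF this] show "norm ((z t - x t) - (z s - x s) - (G (z s) (X t - X s)
          + tensor_apply (deriv_blinfun G (z s) o\<^sub>L G (z s)) (XX s t))) \<le> K * (t - s) powr \<eta>"
        unfolding germ_def by (simp add: algebra_simps)
    qed
    then show ?thesis by (simp add: x0 z0 algebra_simps)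
  qed
  have "rdi_solution \<alpha> X XX \<Omega> F G \<xi> S z"
    unfolding rdi_solution_def
  proof (intro exI conjI)
    \<comment> \<open>The remainder order is \<open>2 * \<alpha>\<close>, so the requirement reads
      \<open>\<alpha> > 1/3\<close>.\<close>
    show "\<alpha> + 2 * \<alpha> > 1" using \<alpha> by simp
    show "controlled_path \<alpha> (2 * \<alpha>) S X z (\<lambda>s. G (z s))"
      by (rule controlled_path_of_germ_bound[OF less_imp_le[OF S(2)] S(3) K(1) L M z[unfolded Z_def] x_lip germ])
    show "\<forall>t\<in>{0..S}. (t, z t) \<in> \<Omega>" using ZK[OF z] K0(2) by blast
    show "abs_continuous_on {0..S} x" by (rule lipschitz_imp_abs_continuous_on[OF x_lip assms(12)])
  qed (use x0 AE ri in auto)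
  then show ?thesis using S by blast
qed

end
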